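(* Let $N\ge1$, $0<p<1$, $-\mu^*<\mu<\frac14$, $\mu\ne0$. For any positive constant $w(0)$ there exists near $r=R$ (respectively near $r=r_0$) a unique local solution of $$u''+\frac{N-1}{r}u'+\frac{\mu}{\delta^2}u=u^p$$ of the form $u(\delta)=\delta^{\beta_+}w(\delta)$, where $w$ is continuous in $[0,\delta_0]$ (for some $\delta_0\in(0,\frac{R-r_0}{2})$) with the prescribed value $w(0)$ at $0$, and $$w(\delta)=w(0)+O(\delta^\alpha),\qquad\text{where }\alpha=\min\{1,\,2-\beta_+(1-p)\}>0.$$ Moreover, if $-\frac{p}{(1-p)^2}<\mu$, then $\alpha=1$ and $w'(0)=\frac{N-1}{2R}w(0)$ at the outer boundary $r=R$, $w'(0)=-\frac{N-1}{2r_0}w(0)$ at the inner boundary $r=r_0$.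
   Context: $\mu^*=\frac{2(p+1)}{(1-p)^2}$, $\beta_+=\frac12+\sqrt{\frac14-\mu}$. The equation is that of radial solutions of $\Delta u+\frac{\mu}{\delta^2}u=u^p$ in the annulus $\{x\in\mathbb{R}^N:r_0<|x|<R\}$, $0<r_0<R$ (the case of a ball $B_R$ coincides with that of the outer boundary). Here $\delta=R-r$ near $r=R$ and $\delta=r-r_0$ near $r=r_0$; derivatives of $u$ are in $r$, that of $w$ in $\delta$. *)

theory Defs
  imports Complex_Main "HOL-Library.Landau_Symbols"
begin

definition mu_star :: "real \<Rightarrow> real" where
  "mu_star p = 2 * (p + 1) / (1 - p)\<^sup>2"

definition beta_plus :: "real \<Rightarrow> real" where
  "beta_plus \<mu> = 1/2 + sqrt (1/4 - \<mu>)"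

definition alpha :: "real \<Rightarrow> real \<Rightarrow> real" where
  "alpha p \<mu> = min 1 (2 - beta_plus \<mu> * (1 - p))"

text \<open>
  Classical solutions of \<open>u'' + (N - 1)/r u' + \<mu>/\<delta>\<^sup>2 u = u\<^sup>p\<close>, derivatives being taken in \<open>r\<close>.
  Nonnegativity belongs to the notion of solution since the power \<open>u\<^sup>p\<close> with
  \<open>0 < p < 1\<close> is only meaningful for \<open>u \<ge> 0\<close>.
\<close>

definition radial_hardy_solution_on ::
    "nat \<Rightarrow> real \<Rightarrow> real \<Rightarrow> (real \<Rightarrow> real) \<Rightarrow> real set \<Rightarrow> (real \<Rightarrow> real) \<Rightarrow> bool" where
  "radial_hardy_solution_on N p \<mu> \<delta> S u \<longleftrightarrow>
     (\<exists>u' u''. \<forall>r\<in>S. 0 \<le> u r \<and>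
        (u has_real_derivative u' r) (at r) \<and>
        (u' has_real_derivative u'' r) (at r) \<and>
        u'' r + (real N - 1) / r * u' r + \<mu> / (\<delta> r)\<^sup>2 * u r = u r powr p)"

text \<open>
  \<open>w\<close>, a function of the distance, is the profile on \<open>[0, \<epsilon>]\<close> of a local solution
  \<open>u = \<delta>\<^sup>\<beta> w(\<delta>)\<close> with \<open>\<beta> = beta_plus \<mu>\<close>. The distance \<open>\<delta>\<close> to the boundary
  component is given as a function of \<open>r\<close>: with \<open>\<delta> r = R - r\<close> the equation is required on
  \<open>R - \<epsilon> < r < R\<close>, with \<open>\<delta> r = r - r0\<close> on \<open>r0 < r < r0 + \<epsilon>\<close>.
\<close>

definition local_profile ::
    "nat \<Rightarrow> real \<Rightarrow> real \<Rightarrow> (real \<Rightarrow> real) \<Rightarrow> real \<Rightarrow> real \<Rightarrow> (real \<Rightarrow> real) \<Rightarrow> bool" where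
  "local_profile N p \<mu> \<delta> w0 \<epsilon> w \<longleftrightarrow>
     continuous_on {0..\<epsilon>} w \<and> w 0 = w0 \<and>
     radial_hardy_solution_on N p \<mu> \<delta> {r. 0 < \<delta> r \<and> \<delta> r < \<epsilon>}
       (\<lambda>r. \<delta> r powr beta_plus \<mu> * w (\<delta> r))"

end

theory Submission
  imports Defs "HOL-Analysis.Analysis"
begin

text \<open>
  With \<open>\<delta> = t\<close> and \<open>u = t powr \<beta> * w\<close>, the equation takes the divergence form \<open>(P * w')' = F t w\<close>, where
  \<open>P t\<close> is \<open>t powr (2 * \<beta>)\<close> times a smooth positive factor. As \<open>2 * \<beta> > 1\<close>, the homogeneous equation
  \<open>P * w' = k\<close> has no bounded solution with \<open>k \<noteq> 0\<close>, so a continuous \<open>w\<close> solves the equation iff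
  \<open>w d = w 0 + (\<integral>s=0..d. (\<integral>t=0..s. F t (w t)) / P s)\<close>. The inner integrand is
  \<open>O(t powr (2 * \<beta> + \<alpha> - 2))\<close>, hence the right-hand side moves \<open>w\<close> away from \<open>w 0\<close> by \<open>O(d powr \<alpha>)\<close> and is a
  contraction on a short interval, because \<open>y powr p\<close> is Lipschitz near \<open>w 0 > 0\<close>.
\<close>

section \<open>Equations in divergence form with a singular weight\<close>

text \<open>\<open>g\<close> may be unbounded at 0 but is dominated by
  \<open>K * s powr (a - 1)\<close>, whose integral over [0, d] is \<open>K / a * d powr a\<close>.
  Since {0} is negligible, integrability is proved on the half-open interval, where \<open>g\<close>
  is continuous and hence measurable.\<close>

lemma integral_powr_bounded:
  fixes g :: "real \<Rightarrow> real"
  assumes cont: "continuous_on {0<..e} g" and a: "0 < a"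
    and bound: "\<And>s. 0 < s \<Longrightarrow> s \<le> e \<Longrightarrow> \<bar>g s\<bar> \<le> K * s powr (a - 1)"
  shows "0 \<le> d \<Longrightarrow> d \<le> e \<Longrightarrow> g integrable_on {0..d}"
    and "0 \<le> d \<Longrightarrow> d \<le> e \<Longrightarrow> \<bar>integral {0..d} g\<bar> \<le> K / a * d powr a"
    and "continuous_on {0..e} (\<lambda>d. integral {0..d} g)"
    and "0 < d \<Longrightarrow> d < e \<Longrightarrow> ((\<lambda>d. integral {0..d} g) has_real_derivative g d) (at d)"
proof -
  have eq: "(f has_integral I) {0..d} \<longleftrightarrow> (f has_integral I) {0<..d}" for f :: "real \<Rightarrow> real" and I d
  proof (rule has_integral_spike_set_eq)
    show "negligible {x \<in> {0..d} - {0<..d}. f x \<noteq> 0}"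
      by (rule negligible_subset[of "{0}"]) auto
    show "negligible {x \<in> {0<..d} - {0..d}. f x \<noteq> 0}"
      by (rule negligible_subset[of "{}"]) auto
  qed
  have dom: "((\<lambda>s. K * s powr (a - 1)) has_integral (K / a * d powr a)) {0<..d}"
    if "0 \<le> d" for d
    using has_integral_mult_right[OF has_integral_powr_from_0[of "a - 1" d], of K] a that
    by (simp flip: eq)
  have int: "g integrable_on {0<..d}" if "0 \<le> d" "d \<le> e" for d
  proof (rule measurable_bounded_by_integrable_imp_integrable)
    show "g \<in> borel_measurable (lebesgue_on {0<..d})"
      using that
      by (intro continuous_imp_measurable_on_sets_lebesgue continuous_on_subset[OF cont]) auto
    show "(\<lambda>s. K * s powr (a - 1)) integrable_on {0<..d}"
      using dom[OF that(1)] by blast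
  qed (use that bound in auto)
  show int0: "g integrable_on {0..d}" if "0 \<le> d" "d \<le> e" for d
    using int[OF that] by (simp add: integrable_on_def eq)
  show "\<bar>integral {0..d} g\<bar> \<le> K / a * d powr a" if "0 \<le> d" "d \<le> e"
  proof -
    have "integral {0..d} g = integral {0<..d} g"
      by (simp add: integral_def integrable_on_def eq)
    also have "norm \<dots> \<le> integral {0<..d} (\<lambda>s. K * s powr (a - 1))"
      using int[OF that] dom[OF that(1)] bound that by (intro integral_norm_bound_integral) auto
    finally show ?thesis
      using integral_unique[OF dom[OF that(1)]] by (simp only: real_norm_def)
  qed
  show "continuous_on {0..e} (\<lambda>d. integral {0..d} g)"
  proof (cases "0 \<le> e")
    case True
    then show ?thesis using int0[of e] by (intro indefinite_integral_continuous_1) auto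
  qed simp
  show "((\<lambda>d. integral {0..d} g) has_real_derivative g d) (at d)" if "0 < d" "d < e"
  proof -
    \<comment> \<open>\<open>g\<close> need not be continuous at 0, so the fundamental theorem is
      applied on [d/2, e]; the integral over [0, d/2] is only an additive constant.\<close>
    have "((\<lambda>x. integral {d/2..x} g) has_real_derivative g d) (at d within {d/2..e})"
      using that by (intro integral_has_real_derivative continuous_on_subset[OF cont]) auto
    then have "((\<lambda>x. integral {0..d/2} g + integral {d/2..x} g) has_real_derivative g d) 
        (at d within {d/2..e})"
      by (rule DERIV_cong[OF DERIV_add[OF DERIV_const]]) simp
    then have "((\<lambda>x. integral {0..x} g) has_real_derivative g d) (at d within {d/2..e})"
    proof (rule has_field_derivative_transform_within[OF _ zero_less_one])
      fix x assume "x \<in> {d/2..e}"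
      then show "integral {0..d/2} g + integral {d/2..x} g = integral {0..x} g"
        using that by (intro Henstock_Kurzweil_Integration.integral_combine int0) auto
    qed (use that in auto)
    then show ?thesis
      using that by (simp add: at_within_Icc_at)
  qed
qed

text \<open>The lower bound keeps division by \<open>P\<close> under control when solutions are
  constructed. The linear upper bound makes \<open>1 / P\<close> nonintegrable at 0, which is what
  excludes further solutions in \<open>solop_unique\<close>.\<close>

locale singular_weight =
  fixes P :: "real \<Rightarrow> real" and b c C \<sigma> :: real
  assumes P_cont: "continuous_on {0<..b} P"
    and P_lower: "\<And>t. 0 < t \<Longrightarrow> t \<le> b \<Longrightarrow> c * t powr \<sigma> \<le> P t"
    and P_upper: "\<And>t. 0 < t \<Longrightarrow> t \<le> b \<Longrightarrow> P t \<le> C * t"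
    and c_pos: "0 < c"
begin

lemma P_pos: "0 < t \<Longrightarrow> t \<le> b \<Longrightarrow> 0 < P t"
  using P_lower[of t] c_pos by (smt (verit) mult_pos_pos powr_gt_zero)

text \<open>For \<open>(P * w')' = h\<close> this is the \<open>w'\<close> selected by requiring
  that \<open>P * w'\<close> vanish at 0; \<open>solop h\<close> below is then the solution with
  value 0 at 0.\<close>

definition flux :: "(real \<Rightarrow> real) \<Rightarrow> real \<Rightarrow> real" where
  "flux h s = integral {0..s} h / P s"

definition solop :: "(real \<Rightarrow> real) \<Rightarrow> real \<Rightarrow> real" where
  "solop h d = integral {0..d} (flux h)"

lemma solop_0 [simp]: "solop h 0 = 0"
  by (simp add: solop_def)

lemma flux_cont:
  assumes "e \<le> b" "continuous_on {0..e} h"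
  shows "continuous_on {0<..e} (flux h)"
proof (cases "0 \<le> e")
  case True
  have "continuous_on {0..e} (\<lambda>s. integral {0..s} h)"
    using assms by (intro indefinite_integral_continuous_1 integrable_continuous_real)
  then have "continuous_on {0<..e} (\<lambda>s. integral {0..s} h)"
    by (rule continuous_on_subset) auto
  moreover have "continuous_on {0<..e} P"
    using P_cont by (rule continuous_on_subset) (use assms in auto)
  moreover have "\<forall>s\<in>{0<..e}. P s \<noteq> 0"
    using P_pos assms by fastforce
  ultimately show ?thesis
    unfolding flux_def by (intro continuous_intros) auto
qed simp

text \<open>The integral of \<open>h\<close> is at most \<open>A * s powr (\<kappa> + 1)\<close>, as
  \<open>\<kappa> + 1 \<ge> 1\<close>; dividing by \<open>c * s powr \<sigma>\<close> lowers the
  exponent by \<sigma>. The final \<open>- 1\<close> is kept to fit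
  \<open>integral_powr_bounded\<close> with \<open>a = \<kappa> + 2 - \<sigma>\<close>.\<close>

lemma flux_bound:
  assumes "e \<le> b" "continuous_on {0..e} h" "0 \<le> \<kappa>"
    and h: "\<And>t. 0 \<le> t \<Longrightarrow> t \<le> e \<Longrightarrow> \<bar>h t\<bar> \<le> A * t powr \<kappa>"
    and s: "0 < s" "s \<le> e"
  shows "\<bar>flux h s\<bar> \<le> A / c * s powr (\<kappa> + 2 - \<sigma> - 1)"
proof -
  have "\<bar>h s\<bar> \<le> A * s powr \<kappa>" using h s by auto
  then have A: "0 \<le> A" using s
    by (smt (verit) mult_neg_pos powr_gt_zero)
  have "\<bar>integral {0..s} h\<bar> \<le> A / (\<kappa> + 1) * s powr (\<kappa> + 1)"
  proof (rule integral_powr_bounded(2)[of e])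
    show "continuous_on {0<..e} h"
      by (rule continuous_on_subset[OF assms(2)]) auto
  qed (use assms in auto)
  also have "\<dots> \<le> A * s powr (\<kappa> + 1)"
    using A assms by (intro mult_right_mono) (auto simp: field_simps)
  finally have "\<bar>flux h s\<bar> \<le> A * s powr (\<kappa> + 1) / (c * s powr \<sigma>)"
    unfolding flux_def abs_divide
    using P_lower[of s] P_pos[of s] c_pos s A assms(1) by (intro frac_le) auto
  also have "\<dots> = A / c * s powr (\<kappa> + 2 - \<sigma> - 1)"
  proof -
    have "\<kappa> + 2 - \<sigma> - 1 = (\<kappa> + 1) - \<sigma>" by simp
    then show ?thesis by (simp only: powr_diff) (simp add: field_simps)
  qed
  finally show ?thesis .
qed

text \<open>With \<open>\<sigma> < \<kappa> + 2\<close> the exponent in \<open>flux_bound\<close>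
  exceeds -1, so the outer integral converges and \<open>solop h\<close> is of order
  \<open>d powr (\<kappa> + 2 - \<sigma>)\<close>.\<close>

context
  fixes h :: "real \<Rightarrow> real" and e \<kappa> A :: real
  assumes e: "e \<le> b" and h_cont: "continuous_on {0..e} h" and \<kappa>: "0 \<le> \<kappa>" "\<sigma> < \<kappa> + 2"
    and h: "\<And>t. 0 \<le> t \<Longrightarrow> t \<le> e \<Longrightarrow> \<bar>h t\<bar> \<le> A * t powr \<kappa>"
begin

lemma flux_bound': "0 < s \<Longrightarrow> s \<le> e \<Longrightarrow> \<bar>flux h s\<bar> \<le> A / c * s powr ((\<kappa> + 2 - \<sigma>) - 1)"
  by (rule flux_bound[OF e h_cont \<kappa>(1) h])

lemma exponent_pos: "0 < \<kappa> + 2 - \<sigma>"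
  using \<kappa> by simp

lemma flux_integrable: "0 \<le> d \<Longrightarrow> d \<le> e \<Longrightarrow> flux h integrable_on {0..d}"
  by (rule integral_powr_bounded(1)[OF flux_cont[OF e h_cont] _ flux_bound']) (use \<kappa> in auto)

lemma solop_bound:
  "0 \<le> d \<Longrightarrow> d \<le> e \<Longrightarrow> \<bar>solop h d\<bar> \<le> A / (c * (\<kappa> + 2 - \<sigma>)) * d powr (\<kappa> + 2 - \<sigma>)"
  using integral_powr_bounded(2)[OF flux_cont[OF e h_cont] exponent_pos flux_bound', of d]
  by (simp add: solop_def)

lemma solop_cont: "continuous_on {0..e} (solop h)"
  using integral_powr_bounded(3)[OF flux_cont[OF e h_cont] exponent_pos flux_bound']
  by (simp add: solop_def[abs_def])

lemma solop_deriv: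
  "0 < d \<Longrightarrow> d < e \<Longrightarrow> (solop h has_real_derivative flux h d) (at d)"
  using integral_powr_bounded(4)[OF flux_cont[OF e h_cont] exponent_pos flux_bound', of d]
  by (simp add: solop_def[abs_def])

lemma P_flux_deriv:
  assumes "0 < d" "d < e"
  shows "((\<lambda>s. P s * flux h s) has_real_derivative h d) (at d)"
proof -
  have "((\<lambda>s. integral {0..s} h) has_real_derivative h d) (at d within {0..e})"
    using assms by (intro integral_has_real_derivative h_cont) auto
  then have "((\<lambda>s. integral {0..s} h) has_real_derivative h d) (at d)"
    using assms by (simp add: at_within_Icc_at)
  then show ?thesis
  proof (rule has_field_derivative_transform_within_open)
    show "integral {0..s} h = P s * flux h s" if "s \<in> {0<..<e}" for s
      using that e P_pos[of s] by (simp add: flux_def)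
  qed (use assms in auto)
qed

text \<open>The conormal derivative of \<open>z - solop h\<close> is constant; a nonzero constant would make
  \<open>z\<close> blow up at least logarithmically at \<open>0\<close>.\<close>

lemma solop_unique:
  assumes z_cont: "continuous_on {0..e} z"
    and z: "\<And>t. 0 < t \<Longrightarrow> t < e \<Longrightarrow> (z has_real_derivative z1 t) (at t)"
    and z1: "\<And>t. 0 < t \<Longrightarrow> t < e \<Longrightarrow> ((\<lambda>t. P t * z1 t) has_real_derivative h t) (at t)"
    and d: "0 \<le> d" "d \<le> e"
  shows "z d = z 0 + solop h d"
proof (cases "e = 0")
  case False
  then have e0: "0 < e" using d by simp
  define y where "y t = z t - solop h t" for t
  define J where "J t = P t * z1 t - P t * flux h t" for t
  have y_cont: "continuous_on {0..e} y"
    unfolding y_def by (intro continuous_intros z_cont solop_cont)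
  have y_deriv: "(y has_real_derivative J t / P t) (at t)" if "0 < t" "t < e" for t
    unfolding y_def J_def
    using P_pos[of t] that e
    by (auto intro!: derivative_eq_intros z solop_deriv simp: field_simps)
  have J_deriv: "(J has_real_derivative 0) (at t)" if "0 < t" "t < e" for t
    using DERIV_diff[OF z1[OF that] P_flux_deriv[OF that]] by (simp add: J_def[abs_def])
  have J_const: "J t = J (e/2)" if "0 < t" "t < e" for t
  proof -
    have "J constant_on {0<..<e}"
      by (rule has_field_derivative_0_imp_constant_on) (auto intro: J_deriv)
    then show ?thesis using that unfolding constant_on_def by force
  qed
  define k where "k = J (e/2)"
  have C: "0 < C"
    using P_pos[of e] P_upper[of e] e e0 by (smt (verit) mult_nonpos_nonneg)
  have "k = 0"
  proof (rule ccontr)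
    assume k: "k \<noteq> 0"
    have "bounded (y ` {0..e})"
      by (intro compact_imp_bounded compact_continuous_image y_cont) auto
    then obtain B where B: "\<And>t. 0 \<le> t \<Longrightarrow> t \<le> e \<Longrightarrow> \<bar>y t\<bar> \<le> B"
      unfolding bounded_iff by fastforce
    \<comment> \<open>As \<open>P t \<le> C * t\<close>, the derivative
      \<open>\<bar>k\<bar> / P t\<close> of \<open>sgn k * y\<close> dominates that of
      \<open>\<bar>k\<bar> / C * ln t\<close>, so \<open>q\<close> is nondecreasing. With
      \<open>y\<close> bounded this bounds \<open>ln t\<close> from below near 0.\<close>
    define q where "q t = sgn k * y t - \<bar>k\<bar> / C * ln t" for t
    have q_deriv: "(q has_real_derivative \<bar>k\<bar> / P t - \<bar>k\<bar> / C / t) (at t)"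
      if "0 < t" "t < e" for t
      unfolding q_def using that J_const[OF that] k C
      by (auto intro!: derivative_eq_intros y_deriv simp: k_def[symmetric] abs_sgn field_simps)
    have q_mono: "q t \<le> q (e/2)" if t: "0 < t" "t < e/2" for t
    proof (rule DERIV_nonneg_imp_nondecreasing[of t "e/2" q])
      fix x assume x: "t \<le> x" "x \<le> e/2"
      have "\<bar>k\<bar> / (C * x) \<le> \<bar>k\<bar> / P x"
        using P_pos[of x] P_upper[of x] x t e C by (intro divide_left_mono mult_pos_pos) auto
      then show "\<exists>y. (q has_real_derivative y) (at x) \<and> 0 \<le> y"
        using q_deriv[of x] x t by (intro exI[of _ "\<bar>k\<bar> / P x - \<bar>k\<bar> / C / x"]) (auto simp: field_simps)
    qed (use t in auto)
    have lower: "- (B + q (e/2)) * C / \<bar>k\<bar> \<le> ln t" if t: "0 < t" "t < e/2" for t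
    proof -
      have "\<bar>sgn k * y t\<bar> \<le> B" using B[of t] t k by (simp add: abs_mult)
      then have "- B - \<bar>k\<bar> / C * ln t \<le> q (e/2)" using q_mono[OF t] unfolding q_def by linarith
      then show ?thesis using C k by (simp add: field_simps)
    qed
    define L where "L = - (B + q (e/2)) * C / \<bar>k\<bar>"
    \<comment> \<open>Small enough for \<open>ln t \<le> L - 1\<close>, contradicting the lower
      bound \<open>L\<close>.\<close>
    define t where "t = min (e/4) (exp (L - 1))"
    have t: "0 < t" "t < e/2" using e0 by (auto simp: t_def)
    have "ln t \<le> ln (exp (L - 1))" using t(1) by (subst ln_le_cancel_iff) (auto simp: t_def)
    then show False using lower[OF t] by (simp add: L_def)
  qed
  then have "(y has_real_derivative 0) (at t)" if "0 < t" "t < e" for t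
    using y_deriv[OF that] J_const[OF that] by (simp add: k_def)
  then have "y d = y 0"
    using DERIV_isconst2[of 0 e y d] e0 y_cont d by auto
  then show ?thesis by (simp add: y_def)
qed (use d in simp)

end

end

lemma (in singular_weight) solop_diff:
  assumes e: "e \<le> b" and \<kappa>: "0 \<le> \<kappa>" "\<sigma> < \<kappa> + 2"
    and h1: "continuous_on {0..e} h1" "\<And>t. 0 \<le> t \<Longrightarrow> t \<le> e \<Longrightarrow> \<bar>h1 t\<bar> \<le> A1 * t powr \<kappa>"
    and h2: "continuous_on {0..e} h2" "\<And>t. 0 \<le> t \<Longrightarrow> t \<le> e \<Longrightarrow> \<bar>h2 t\<bar> \<le> A2 * t powr \<kappa>"
    and d: "0 \<le> d" "d \<le> e"
  shows "solop h1 d - solop h2 d = solop (\<lambda>t. h1 t - h2 t) d"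
proof -
  have "solop h1 d - solop h2 d = integral {0..d} (\<lambda>s. flux h1 s - flux h2 s)"
    unfolding solop_def
    by (rule integral_diff[symmetric])
       (rule flux_integrable[OF e h1(1) \<kappa> h1(2) d] flux_integrable[OF e h2(1) \<kappa> h2(2) d]; assumption)+
  also have "\<dots> = solop (\<lambda>t. h1 t - h2 t) d"
    unfolding solop_def
  proof (rule integral_cong)
    fix s assume s: "s \<in> {0..d}"
    then have "continuous_on {0..s} h1" "continuous_on {0..s} h2"
      using h1(1) h2(1) d by (auto intro: continuous_on_subset)
    then have "integral {0..s} (\<lambda>t. h1 t - h2 t) = integral {0..s} h1 - integral {0..s} h2"
      by (intro integral_diff integrable_continuous_real)
    then show "flux h1 s - flux h2 s = flux (\<lambda>t. h1 t - h2 t) s"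
      by (simp add: flux_def diff_divide_distrib)
  qed
  finally show ?thesis .
qed

section \<open>The nonlinear integral equation by contraction\<close>

locale singular_ivp = singular_weight +
  fixes f :: "real \<Rightarrow> real \<Rightarrow> real" and A L \<kappa> e :: real
  assumes \<kappa>: "0 \<le> \<kappa>" "\<sigma> < \<kappa> + 2"
    and e: "0 < e" "e \<le> b"
    and f_cont: "continuous_on ({0..e} \<times> UNIV) (\<lambda>(t, y). f t y)"
    and f_bound: "\<And>t y. 0 \<le> t \<Longrightarrow> t \<le> e \<Longrightarrow> \<bar>f t y\<bar> \<le> A * t powr \<kappa>"
    and f_lipschitz: "\<And>t x y. 0 \<le> t \<Longrightarrow> t \<le> e \<Longrightarrow> \<bar>f t x - f t y\<bar> \<le> L * t powr \<kappa> * \<bar>x - y\<bar>"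
    and contractive: "L / (c * (\<kappa> + 2 - \<sigma>)) * e powr (\<kappa> + 2 - \<sigma>) \<le> 1 / 2"
begin

lemma L_nonneg: "0 \<le> L"
  using f_lipschitz[of e 1 0] e by (smt (verit) mult_neg_pos powr_gt_zero)

lemma f_comp_cont:
  assumes "d \<le> e" "continuous_on {0..d} w"
  shows "continuous_on {0..d} (\<lambda>t. f t (w t))"
proof -
  have "continuous_on {0..d} ((\<lambda>(t, y). f t y) \<circ> (\<lambda>t. (t, w t)))"
    by (intro continuous_on_compose continuous_on_subset[OF f_cont] continuous_intros assms)
       (use assms in auto)
  then show ?thesis by (simp add: o_def)
qed

text \<open>The difference of the two sources is at most \<open>L * M * t powr \<kappa>\<close>, so
  \<open>solop_bound\<close> applies with constant \<open>L * M\<close>, and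
  \<open>contractive\<close> makes the resulting factor at most 1/2. A subinterval [0, d] is allowed
  because a competing solution may live on a shorter interval.\<close>

lemma contraction:
  assumes d: "0 \<le> d" "d \<le> e" and v: "continuous_on {0..d} v" and w: "continuous_on {0..d} w"
    and M: "\<And>t. 0 \<le> t \<Longrightarrow> t \<le> d \<Longrightarrow> \<bar>v t - w t\<bar> \<le> M"
    and x: "0 \<le> x" "x \<le> d"
  shows "\<bar>solop (\<lambda>t. f t (v t)) x - solop (\<lambda>t. f t (w t)) x\<bar> \<le> M / 2"
proof -
  let ?h = "\<lambda>t. f t (v t) - f t (w t)"
  have M0: "0 \<le> M" using M[of 0] d by simp
  have db: "d \<le> b" using d e by simp
  have cv: "continuous_on {0..d} (\<lambda>t. f t (v t))" and cw: "continuous_on {0..d} (\<lambda>t. f t (w t))"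
    using f_comp_cont d v w by auto
  have bound: "\<bar>f t y\<bar> \<le> A * t powr \<kappa>" if "0 \<le> t" "t \<le> d" for t y
    using f_bound that d by auto
  have h: "\<bar>?h t\<bar> \<le> (L * M) * t powr \<kappa>" if "0 \<le> t" "t \<le> d" for t
  proof -
    have "\<bar>?h t\<bar> \<le> L * t powr \<kappa> * \<bar>v t - w t\<bar>" using f_lipschitz that d by auto
    also have "\<dots> \<le> L * t powr \<kappa> * M" using M that L_nonneg by (intro mult_left_mono) auto
    finally show ?thesis by (simp add: mult_ac)
  qed
  have "solop (\<lambda>t. f t (v t)) x - solop (\<lambda>t. f t (w t)) x = solop ?h x"
    by (rule solop_diff[OF db \<kappa> cv bound cw bound x])
  also have "\<bar>\<dots>\<bar> \<le> (L * M) / (c * (\<kappa> + 2 - \<sigma>)) * x powr (\<kappa> + 2 - \<sigma>)"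
    by (rule solop_bound[OF db continuous_on_diff[OF cv cw] \<kappa> h x])
  also have "\<dots> \<le> (L * M) / (c * (\<kappa> + 2 - \<sigma>)) * e powr (\<kappa> + 2 - \<sigma>)"
    using L_nonneg M0 c_pos \<kappa> x d
    by (intro mult_left_mono powr_mono2 divide_nonneg_pos mult_nonneg_nonneg mult_pos_pos) auto
  also have "\<dots> = M * (L / (c * (\<kappa> + 2 - \<sigma>)) * e powr (\<kappa> + 2 - \<sigma>))" by simp
  also have "\<dots> \<le> M * (1 / 2)" using contractive M0 by (rule mult_left_mono)
  finally show ?thesis by simp
qed

text \<open>Applied at a point where \<open>\<bar>v - w\<bar>\<close> is maximal,
  \<open>contraction\<close> bounds the maximum by half of itself.\<close>

lemma fixpoint_unique:
  assumes d: "0 \<le> d" "d \<le> e" and v: "continuous_on {0..d} v" and w: "continuous_on {0..d} w"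
    and v_eq: "\<And>x. 0 \<le> x \<Longrightarrow> x \<le> d \<Longrightarrow> v x = w0 + solop (\<lambda>t. f t (v t)) x"
    and w_eq: "\<And>x. 0 \<le> x \<Longrightarrow> x \<le> d \<Longrightarrow> w x = w0 + solop (\<lambda>t. f t (w t)) x"
    and x: "0 \<le> x" "x \<le> d"
  shows "v x = w x"
proof -
  have "continuous_on {0..d} (\<lambda>t. \<bar>v t - w t\<bar>)" by (intro continuous_intros v w)
  then obtain y where y: "y \<in> {0..d}" "\<And>t. t \<in> {0..d} \<Longrightarrow> \<bar>v t - w t\<bar> \<le> \<bar>v y - w y\<bar>"
    using continuous_attains_sup[of "{0..d}"] d by fastforce
  have "\<bar>v y - w y\<bar> \<le> \<bar>v y - w y\<bar> / 2"
    using contraction[OF d v w, of "\<bar>v y - w y\<bar>" y] y v_eq[of y] w_eq[of y] by auto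
  then show ?thesis using y(2)[of x] x by auto
qed

lemma fixpoint_exists:
  obtains w where "continuous_on {0..e} w"
    and "\<And>x. 0 \<le> x \<Longrightarrow> x \<le> e \<Longrightarrow> w x = w0 + solop (\<lambda>t. f t (w t)) x"
proof -
  \<comment> \<open>Projection onto [0, e]: composing with it extends functions to the whole line,
    so that Banach's theorem can be used in the complete space of bounded continuous
    functions.\<close>
  define clip where "clip x = max 0 (min e x)" for x
  have clip: "0 \<le> clip x" "clip x \<le> e" for x using e by (auto simp: clip_def)
  define T where "T w x = w0 + solop (\<lambda>t. f t (w t)) (clip x)" for w :: "real \<Rightarrow> real" and x
  have T: "T w \<in> bcontfun" if w: "continuous_on {0..e} w" for w
  proof (rule bcontfun_normI)
    have "continuous_on UNIV (solop (\<lambda>t. f t (w t)) \<circ> clip)"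
      by (intro continuous_on_compose
           continuous_on_subset[OF solop_cont[OF e(2) f_comp_cont[OF order_refl w] \<kappa> f_bound]])
         (use clip in \<open>auto simp: clip_def[abs_def] intro!: continuous_intros\<close>)
    then show "continuous_on UNIV (T w)"
      unfolding T_def[abs_def] o_def by (intro continuous_intros)
    fix x
    have "\<bar>solop (\<lambda>t. f t (w t)) (clip x)\<bar> \<le> A / (c * (\<kappa> + 2 - \<sigma>)) * clip x powr (\<kappa> + 2 - \<sigma>)"
      by (rule solop_bound[OF e(2) f_comp_cont[OF order_refl w] \<kappa> f_bound clip])
    also have "\<dots> \<le> \<bar>A / (c * (\<kappa> + 2 - \<sigma>))\<bar> * e powr (\<kappa> + 2 - \<sigma>)"
      using clip \<kappa> by (intro mult_mono powr_mono2 abs_ge_self) auto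
    finally show "norm (T w x) \<le> \<bar>w0\<bar> + \<bar>A / (c * (\<kappa> + 2 - \<sigma>))\<bar> * e powr (\<kappa> + 2 - \<sigma>)"
      unfolding T_def real_norm_def by linarith
  qed
  have apply_T: "apply_bcontfun (Bcontfun (T (apply_bcontfun g))) = T (apply_bcontfun g)" for g
    by (intro Bcontfun_inverse T) auto
  have "dist (Bcontfun (T (apply_bcontfun g))) (Bcontfun (T (apply_bcontfun h))) \<le> 1 / 2 * dist g h"
    for g h :: "real \<Rightarrow>\<^sub>C real"
  proof (rule dist_bound)
    fix x
    have "\<bar>solop (\<lambda>t. f t (g t)) (clip x) - solop (\<lambda>t. f t (h t)) (clip x)\<bar> \<le> dist g h / 2"
      by (rule contraction[of e])
         (use e clip dist_bounded[of g _ h] in \<open>auto simp: dist_real_def\<close>)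
    then show "dist (Bcontfun (T (apply_bcontfun g)) x) (Bcontfun (T (apply_bcontfun h)) x)
        \<le> 1 / 2 * dist g h"
      by (simp add: apply_T) (simp add: T_def dist_real_def)
  qed
  then have "\<exists>!g. Bcontfun (T (apply_bcontfun g)) = g"
    by (intro banach_fix_type[of "1/2"]) auto
  then obtain g :: "real \<Rightarrow>\<^sub>C real" where "Bcontfun (T (apply_bcontfun g)) = g" by blast
  then have g: "apply_bcontfun g = T (apply_bcontfun g)" using apply_T by metis
  show ?thesis
  proof
    show "continuous_on {0..e} (apply_bcontfun g)" by simp
    show "g x = w0 + solop (\<lambda>t. f t (g t)) x" if "0 \<le> x" "x \<le> e" for x
      by (subst g) (use that in \<open>simp add: T_def clip_def\<close>)
  qed
qed

end

section \<open>The radial Hardy equation\<close>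

text \<open>\<open>\<rho>\<close> is the radius of the boundary component, \<open>s = -1\<close> for the outer and \<open>s = 1\<close> for the inner one;
  the point at distance \<open>t\<close> has radius \<open>\<rho> + s * t\<close>.\<close>

locale hardy_ode =
  fixes N :: nat and p \<mu> s \<rho> w0 :: real
  assumes N: "1 \<le> N" and p: "0 < p" "p < 1"
    and \<mu>: "- mu_star p < \<mu>" "\<mu> < 1/4"
    and s: "s = 1 \<or> s = -1" and \<rho>: "0 < \<rho>" and w0: "0 < w0"
begin

abbreviation \<beta> :: real where "\<beta> \<equiv> beta_plus \<mu>"

abbreviation \<alpha> :: real where "\<alpha> \<equiv> alpha p \<mu>"

text \<open>The coefficient of the first derivative once the distance \<open>t\<close> replaces the
  radius: d/dr is \<open>s\<close> d/dt because \<open>s * s = 1\<close>.\<close>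

definition a :: "real \<Rightarrow> real" where
  "a t = s * (real N - 1) / (\<rho> + s * t)"

definition m :: "real \<Rightarrow> real" where
  "m t = (\<rho> + s * t) powr (real N - 1)"

definition P :: "real \<Rightarrow> real" where
  "P t = m t * t powr (2 * \<beta>)"

text \<open>For \<open>u (\<rho> + s * t) = t powr \<beta> * w t\<close> the radial equation becomes \<open>(P * w')' = F t w\<close>: since \<open>\<beta>\<close>
  is a root of \<open>\<beta> * (\<beta> - 1) + \<mu> = 0\<close> the Hardy term cancels, and \<open>m\<close> is an integrating factor
  of \<open>a\<close>.\<close>

definition F :: "real \<Rightarrow> real \<Rightarrow> real" where
  "F t y = m t * (t powr (\<beta> * (1 + p)) * y powr p - \<beta> * a t * t powr (2 * \<beta> - 1) * y)"

section \<open>The exponents \<beta>, \<alpha> and \<kappa>\<close>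

lemma beta_gt_half: "1/2 < \<beta>"
  using \<mu> by (simp add: beta_plus_def)

lemma beta_root: "\<beta> * (\<beta> - 1) = - \<mu>"
proof -
  have "(sqrt (1/4 - \<mu>))\<^sup>2 = 1/4 - \<mu>" using \<mu> by simp
  then show ?thesis by (simp add: beta_plus_def power2_eq_square algebra_simps)
qed

text \<open>The inequality for \<beta> says \<open>sqrt (1/4 - \<mu>) < x / (1 - p) - 1/2\<close>;
  the assumption makes the bound nonnegative, so squaring is an equivalence. The values
  \<open>x = 2\<close> and \<open>x = 1\<close> give the two thresholds on \<mu> in the
  theorem.\<close>

lemma beta_less_iff:
  assumes "1 - p \<le> 2 * x"
  shows "\<beta> * (1 - p) < x \<longleftrightarrow> 1/4 - ((2 * x - (1 - p)) / (2 * (1 - p)))\<^sup>2 < \<mu>"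
proof -
  define y where "y = (2 * x - (1 - p)) / (2 * (1 - p))"
  have y: "0 \<le> y" using assms p by (simp add: y_def)
  have "\<beta> * (1 - p) < x \<longleftrightarrow> sqrt (1/4 - \<mu>) < y"
    using p by (simp add: beta_plus_def y_def field_simps)
  also have "\<dots> \<longleftrightarrow> sqrt (1/4 - \<mu>) < sqrt (y\<^sup>2)" using y by simp
  also have "\<dots> \<longleftrightarrow> 1/4 - y\<^sup>2 < \<mu>" by (subst real_sqrt_less_iff) auto
  finally show ?thesis by (simp add: y_def)
qed

lemma alpha_pos: "0 < \<alpha>"
proof -
  \<comment> \<open>For \<open>x = 2\<close> and \<open>q = 1 - p\<close> the threshold of
    \<open>beta_less_iff\<close> is \<open>- mu_star p\<close>.\<close>
  have "1/4 - ((2 * 2 - q) / (2 * q))\<^sup>2 = - (2 * ((1 - q) + 1) / q\<^sup>2)" if "q \<noteq> 0" for q :: real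
    using that by (simp add: power2_eq_square field_simps)
  from this[of "1 - p"] have "\<beta> * (1 - p) < 2 \<longleftrightarrow> - mu_star p < \<mu>"
    using p beta_less_iff[of 2] by (simp add: mu_star_def)
  then show ?thesis using \<mu> by (simp add: alpha_def)
qed

lemma beta_less_1:
  assumes "- p / (1 - p)\<^sup>2 < \<mu>"
  shows "\<beta> * (1 - p) < 1"
proof -
  have "1/4 - ((2 * 1 - q) / (2 * q))\<^sup>2 = - (1 - q) / q\<^sup>2" if "q \<noteq> 0" for q :: real
    using that by (simp add: power2_eq_square field_simps)
  from this[of "1 - p"] show ?thesis using p assms beta_less_iff[of 1] by simp
qed

lemma alpha_eq_1: "- p / (1 - p)\<^sup>2 < \<mu> \<Longrightarrow> \<alpha> = 1"
  using beta_less_1 by (simp add: alpha_def)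

text \<open>Chosen so that \<open>\<kappa> + 2 - 2 * \<beta> = \<alpha>\<close>, which turns
  \<open>solop_bound\<close> into the estimate of order \<alpha>. By \<open>\<kappa>_eq\<close> it
  is also the smaller of the two powers of \<open>t\<close> in \<open>F\<close>.\<close>

definition \<kappa> :: real where "\<kappa> = 2 * \<beta> + \<alpha> - 2"

lemma \<kappa>_eq: "\<kappa> = min (2 * \<beta> - 1) (\<beta> * (1 + p))"
  by (auto simp: \<kappa>_def alpha_def min_def algebra_simps)

lemma \<kappa>_pos: "0 < \<kappa>"
  using beta_gt_half p by (simp add: \<kappa>_eq)

lemma s_sq: "s * s = 1" "s * (s * x) = x" "s * (x * s) = x"
  using s by auto

section \<open>Equivalence of the radial equation and the divergence form\<close>

lemma radius_bounds:
  assumes "0 \<le> t" "t \<le> \<rho> / 2"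
  shows "\<rho> / 2 \<le> \<rho> + s * t" "\<rho> + s * t \<le> 2 * \<rho>"
  using assms s \<rho> by auto

lemma m_deriv:
  assumes "0 < \<rho> + s * t"
  shows "(m has_real_derivative a t * m t) (at t)"
proof -
  have "((\<lambda>t. \<rho> + s * t) has_real_derivative s) (at t)"
    by (auto intro!: derivative_eq_intros)
  from DERIV_chain2[OF has_real_derivative_powr[OF assms] this, of "real N - 1"]
  show ?thesis
    unfolding m_def[abs_def] by (rule DERIV_cong) (use assms in \<open>simp add: a_def powr_diff power2_eq_square mult_ac\<close>)
qed

lemma X_deriv:
  assumes "0 < t"
  shows "((\<lambda>t. t powr \<beta>) has_real_derivative \<beta> / t * t powr \<beta>) (at t)"
  using assms by (auto intro!: derivative_eq_intros simp: powr_diff)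

lemma m_pos: "0 < \<rho> + s * t \<Longrightarrow> 0 < m t"
  by (simp add: m_def)

lemma P_eq: "0 < t \<Longrightarrow> P t = m t * (t powr \<beta>)\<^sup>2"
  by (simp add: P_def power2_eq_square flip: powr_add)

text \<open>Here the power term is \<open>u powr p\<close> with
  \<open>u = t powr \<beta> * y\<close>, the form in which the radial equation supplies it.\<close>

lemma F_eq:
  assumes "0 < t" "0 \<le> y"
  shows "F t y = m t * t powr \<beta> * ((t powr \<beta> * y) powr p - \<beta> / t * a t * t powr \<beta> * y)"
proof -
  have "t powr (\<beta> * (1 + p)) = t powr \<beta> * (t powr \<beta>) powr p"
    by (simp add: powr_powr distrib_left flip: powr_add)
  moreover have "t powr (2 * \<beta> - 1) = t powr \<beta> * t powr \<beta> / t"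
    using assms by (simp add: powr_diff flip: powr_add)
  ultimately show ?thesis
    using assms by (simp add: F_def powr_mult algebra_simps)
qed

text \<open>With \<open>U = X * v\<close> and \<open>X = t powr \<beta>\<close>,
  \<open>P * v'\<close> equals \<open>m * (X * U' - X' * U)\<close>. On differentiating, the terms
  \<open>X' * U'\<close> cancel, \<open>m' = a * m\<close> supplies the drift, and
  \<open>X''\<close> supplies the Hardy term.\<close>

lemma radial_to_divergence:
  assumes e: "\<And>t. 0 < t \<Longrightarrow> t < e \<Longrightarrow> 0 < \<rho> + s * t"
    and u: "radial_hardy_solution_on N p \<mu> (\<lambda>r. s * (r - \<rho>)) {r. 0 < s * (r - \<rho>) \<and> s * (r - \<rho>) < e}
      (\<lambda>r. (s * (r - \<rho>)) powr \<beta> * v (s * (r - \<rho>)))"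
  obtains v1 where "\<And>t. 0 < t \<Longrightarrow> t < e \<Longrightarrow> (v has_real_derivative v1 t) (at t)"
    and "\<And>t. 0 < t \<Longrightarrow> t < e \<Longrightarrow> 0 \<le> v t \<Longrightarrow> ((\<lambda>t. P t * v1 t) has_real_derivative F t (v t)) (at t)"
proof -
  define X where "X t = t powr \<beta>" for t
  define u where "u r = X (s * (r - \<rho>)) * v (s * (r - \<rho>))" for r
  obtain u' u'' where u: "\<And>r. 0 < s * (r - \<rho>) \<Longrightarrow> s * (r - \<rho>) < e \<Longrightarrow>
        (u has_real_derivative u' r) (at r) \<and>
        (u' has_real_derivative u'' r) (at r) \<and>
        u'' r + (real N - 1) / r * u' r + \<mu> / (s * (r - \<rho>))\<^sup>2 * u r = u r powr p"
    using assms(2) unfolding radial_hardy_solution_on_def u_def[abs_def] X_def by blast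
  have ss: "s * ((\<rho> + s * t) - \<rho>) = t" for t
    using s_sq by (simp add: algebra_simps flip: mult.assoc)
  define U where "U t = u (\<rho> + s * t)" for t
  define U1 where "U1 t = s * u' (\<rho> + s * t)" for t
  define U2 where "U2 t = u'' (\<rho> + s * t)" for t
  have X: "0 < X t" "(X has_real_derivative \<beta> / t * X t) (at t)" if "0 < t" for t
    using that X_deriv[OF that] by (auto simp: X_def[abs_def])
  have U_eq: "U t = X t * v t" for t by (simp only: U_def u_def ss)
  have lin: "((\<lambda>t. \<rho> + s * t) has_real_derivative s) (at t)" for t
    by (auto intro!: derivative_eq_intros)
  have U: "(U has_real_derivative U1 t) (at t)" and U1: "(U1 has_real_derivative U2 t) (at t)"
    and eq: "U2 t + a t * U1 t + \<mu> / t\<^sup>2 * U t = U t powr p" if "0 < t" "t < e" for t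
  proof -
    have *: "(u has_real_derivative u' (\<rho> + s * t)) (at (\<rho> + s * t))"
      "(u' has_real_derivative u'' (\<rho> + s * t)) (at (\<rho> + s * t))"
      "u'' (\<rho> + s * t) + (real N - 1) / (\<rho> + s * t) * u' (\<rho> + s * t) + \<mu> / t\<^sup>2 * u (\<rho> + s * t)
        = u (\<rho> + s * t) powr p"
      using u[of "\<rho> + s * t"] that unfolding ss by auto
    show "(U has_real_derivative U1 t) (at t)"
      using DERIV_chain2[OF *(1) lin] by (simp add: U_def[abs_def] U1_def mult.commute)
    show "(U1 has_real_derivative U2 t) (at t)"
      using DERIV_cmult[OF DERIV_chain2[OF *(2) lin], of s] s_sq
      by (simp add: U1_def[abs_def] U2_def mult.left_commute)
    have "a t * U1 t = (s * s) * ((real N - 1) / (\<rho> + s * t) * u' (\<rho> + s * t))"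
      by (simp add: a_def U1_def)
    then show "U2 t + a t * U1 t + \<mu> / t\<^sup>2 * U t = U t powr p"
      using *(3) s_sq by (simp add: U_def U2_def)
  qed
  \<comment> \<open>Quotient rule for \<open>v = U / X\<close>, using
    \<open>X' = \<beta> / t * X\<close>.\<close>
  define v1 where "v1 t = U1 t / X t - \<beta> / t * v t" for t
  have v: "(v has_real_derivative v1 t) (at t)" if t: "0 < t" "t < e" for t
  proof -
    have "((\<lambda>t. U t / X t) has_real_derivative v1 t) (at t)"
      by (rule DERIV_cong[OF DERIV_divide[OF U[OF t] X(2)[OF t(1)]]])
         (use X[OF t(1)] t in \<open>simp_all add: v1_def U_eq field_simps\<close>)
    then show ?thesis
      by (rule has_field_derivative_transform_within_open[of _ _ _ "{0<..<e}"])
         (use t X in \<open>auto simp: U_eq less_imp_neq[symmetric]\<close>)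
  qed
  moreover have "((\<lambda>t. P t * v1 t) has_real_derivative F t (v t)) (at t)"
    if t: "0 < t" "t < e" "0 \<le> v t" for t
  proof -
    have U1_eq: "U1 t = X t * v1 t + \<beta> / t * X t * v t"
      using X[OF t(1)] t by (simp add: v1_def field_simps)
    \<comment> \<open>\<open>P * v1\<close> is written through \<open>m\<close>, \<open>X\<close>,
      \<open>U1\<close> and \<open>v\<close>, whose derivatives are already known.\<close>
    have "((\<lambda>t. m t * (X t * U1 t - \<beta> / t * (X t)\<^sup>2 * v t)) has_real_derivative
      (a t * m t) * (X t * U1 t - \<beta> / t * (X t)\<^sup>2 * v t) + m t * (\<beta> / t * X t * U1 t + X t * U2 t
        + \<beta> / t\<^sup>2 * (X t)\<^sup>2 * v t - \<beta> / t * (2 * X t * (\<beta> / t * X t)) * v t - \<beta> / t * (X t)\<^sup>2 * v1 t)) (at t)"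
      using t X[OF t(1)]
      by (auto intro!: derivative_eq_intros m_deriv e U1 v simp: power2_eq_square field_simps)
    also have "(a t * m t) * (X t * U1 t - \<beta> / t * (X t)\<^sup>2 * v t) + m t * (\<beta> / t * X t * U1 t + X t * U2 t
        + \<beta> / t\<^sup>2 * (X t)\<^sup>2 * v t - \<beta> / t * (2 * X t * (\<beta> / t * X t)) * v t - \<beta> / t * (X t)\<^sup>2 * v1 t)
      = m t * X t * (U2 t + a t * U1 t - \<beta> * (\<beta> - 1) / t\<^sup>2 * (X t * v t) - \<beta> / t * a t * X t * v t)"
      unfolding U1_eq using t by (simp add: field_simps power2_eq_square)
    also have "\<dots> = F t (v t)"
      using eq[OF t(1,2)] t unfolding beta_root F_eq[OF t(1,3)] U_eq by (simp add: X_def)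
    finally show ?thesis
    proof (rule has_field_derivative_transform_within_open[of _ _ _ "{0<..<e}"])
      fix t assume "t \<in> {0<..<e}"
      then show "m t * (X t * U1 t - \<beta> / t * (X t)\<^sup>2 * v t) = P t * v1 t"
        using X(1)[of t] by (simp add: P_eq v1_def field_simps power2_eq_square flip: X_def)
    qed (use t in auto)
  qed
  ultimately show ?thesis using that by blast
qed

text \<open>Conversely, \<open>v1 = (P * v1) / P\<close> is differentiable because \<open>P\<close>
  is differentiable and positive, so \<open>u\<close> has the two derivatives that the radial
  equation needs.\<close>

lemma divergence_to_radial:
  assumes e: "\<And>t. 0 < t \<Longrightarrow> t < e \<Longrightarrow> 0 < \<rho> + s * t"
    and nonneg: "\<And>t. 0 < t \<Longrightarrow> t < e \<Longrightarrow> 0 \<le> v t"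
    and v: "\<And>t. 0 < t \<Longrightarrow> t < e \<Longrightarrow> (v has_real_derivative v1 t) (at t)"
    and Pv1: "\<And>t. 0 < t \<Longrightarrow> t < e \<Longrightarrow> ((\<lambda>t. P t * v1 t) has_real_derivative F t (v t)) (at t)"
  shows "radial_hardy_solution_on N p \<mu> (\<lambda>r. s * (r - \<rho>)) {r. 0 < s * (r - \<rho>) \<and> s * (r - \<rho>) < e}
      (\<lambda>r. (s * (r - \<rho>)) powr \<beta> * v (s * (r - \<rho>)))"
proof -
  define X where "X t = t powr \<beta>" for t
  have X: "0 < X t" "(X has_real_derivative \<beta> / t * X t) (at t)" if "0 < t" for t
    using that X_deriv[OF that] by (auto simp: X_def[abs_def])
  \<comment> \<open>Obtained from \<open>P * v2 + P' * v1 = F t (v t)\<close>, since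
    \<open>P = m * X\<^sup>2\<close> has logarithmic derivative
    \<open>a + 2 * \<beta> / t\<close>.\<close>
  define v2 where "v2 t = F t (v t) / (m t * (X t)\<^sup>2) - (a t + 2 * \<beta> / t) * v1 t" for t
  \<comment> \<open>\<open>U1\<close> and \<open>U2\<close> are the first two derivatives of
    \<open>X * v\<close>; here \<open>X''\<close> is
    \<open>\<beta> * (\<beta> - 1) / t\<^sup>2 * X\<close>.\<close>
  define U1 where "U1 t = X t * v1 t + \<beta> / t * X t * v t" for t
  define U2 where "U2 t = X t * (2 * \<beta> / t * v1 t + v2 t + \<beta> * (\<beta> - 1) / t\<^sup>2 * v t)" for t
  have v1: "(v1 has_real_derivative v2 t) (at t)" if t: "0 < t" "t < e" for t
  proof -
    have "((\<lambda>t. m t * (X t)\<^sup>2) has_real_derivative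
      a t * m t * (X t)\<^sup>2 + m t * (2 * X t * (\<beta> / t * X t))) (at t)"
      using t X[OF t(1)] by (auto intro!: derivative_eq_intros m_deriv e)
    from DERIV_divide[OF Pv1[OF t] this]
    have "((\<lambda>t. (P t * v1 t) / (m t * (X t)\<^sup>2)) has_real_derivative
      (F t (v t) * (m t * (X t)\<^sup>2) - (P t * v1 t) * (a t * m t * (X t)\<^sup>2 + m t * (2 * X t * (\<beta> / t * X t))))
       / (m t * (X t)\<^sup>2)\<^sup>2) (at t)"
      using X[OF t(1)] m_pos[OF e[OF t]] by (simp add: power2_eq_square)
    also have "(F t (v t) * (m t * (X t)\<^sup>2) - (P t * v1 t) * (a t * m t * (X t)\<^sup>2 + m t * (2 * X t * (\<beta> / t * X t))))
       / (m t * (X t)\<^sup>2)\<^sup>2 = v2 t"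
      using t X(1)[OF t(1)] m_pos[OF e[OF t]]
      by (simp add: P_eq v2_def field_simps power2_eq_square flip: X_def)
    finally show ?thesis
    proof (rule has_field_derivative_transform_within_open[of _ _ _ "{0<..<e}"])
      fix t assume "t \<in> {0<..<e}"
      then show "(P t * v1 t) / (m t * (X t)\<^sup>2) = v1 t"
        using X(1)[of t] m_pos[OF e, of t] by (simp add: P_eq flip: X_def)
    qed (use t in auto)
  qed
  have U: "((\<lambda>t. X t * v t) has_real_derivative U1 t) (at t)"
    and U1: "(U1 has_real_derivative U2 t) (at t)"
    and eq: "U2 t + a t * U1 t + \<mu> / t\<^sup>2 * (X t * v t) = (X t * v t) powr p"
    if t: "0 < t" "t < e" for t
  proof -
    show "((\<lambda>t. X t * v t) has_real_derivative U1 t) (at t)"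
      using t X[OF t(1)] by (auto intro!: derivative_eq_intros v simp: U1_def)
    show "(U1 has_real_derivative U2 t) (at t)"
      unfolding U1_def[abs_def] using t X[OF t(1)]
      by (auto intro!: derivative_eq_intros v v1 simp: U2_def field_simps power2_eq_square)
    have "U2 t + a t * U1 t + \<mu> / t\<^sup>2 * (X t * v t)
        = F t (v t) / (m t * X t) + a t * (\<beta> / t * X t * v t)"
      using t X(1)[OF t(1)] m_pos[OF e[OF t]]
      unfolding U2_def U1_def v2_def beta_root by (simp add: field_simps power2_eq_square)
    also have "\<dots> = (X t * v t) powr p"
      using t X(1)[OF t(1)] m_pos[OF e[OF t]]
      unfolding F_eq[OF t(1) nonneg[OF t]] X_def[symmetric] by (simp add: field_simps)
    finally show "U2 t + a t * U1 t + \<mu> / t\<^sup>2 * (X t * v t) = (X t * v t) powr p" .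
  qed
  have lin: "((\<lambda>r. s * (r - \<rho>)) has_real_derivative s) (at r)" for r
    by (auto intro!: derivative_eq_intros)
  show ?thesis
    unfolding radial_hardy_solution_on_def
  \<comment> \<open>Each derivative in \<open>r\<close> contributes a factor \<open>s\<close>; in
    the second one \<open>s * s = 1\<close>.\<close>
  proof (rule exI[of _ "\<lambda>r. s * U1 (s * (r - \<rho>))"], rule exI[of _ "\<lambda>r. U2 (s * (r - \<rho>))"],
      intro ballI conjI)
    fix r assume "r \<in> {r. 0 < s * (r - \<rho>) \<and> s * (r - \<rho>) < e}"
    then have t: "0 < s * (r - \<rho>)" "s * (r - \<rho>) < e" by auto
    have r: "\<rho> + s * (s * (r - \<rho>)) = r"
      using s_sq by (simp flip: mult.assoc)
    show "0 \<le> (s * (r - \<rho>)) powr \<beta> * v (s * (r - \<rho>))" using nonneg[OF t] by simp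
    show "((\<lambda>r. (s * (r - \<rho>)) powr \<beta> * v (s * (r - \<rho>))) has_real_derivative s * U1 (s * (r - \<rho>))) (at r)"
      using DERIV_chain2[OF U[OF t] lin] by (simp add: X_def mult.commute)
    show "((\<lambda>r. s * U1 (s * (r - \<rho>))) has_real_derivative U2 (s * (r - \<rho>))) (at r)"
      using DERIV_cmult[OF DERIV_chain2[OF U1[OF t] lin], of s] s_sq by (simp add: mult.left_commute)
    have "(real N - 1) / r * (s * U1 (s * (r - \<rho>))) = a (s * (r - \<rho>)) * U1 (s * (r - \<rho>))"
      unfolding a_def r by simp
    then show "U2 (s * (r - \<rho>)) + (real N - 1) / r * (s * U1 (s * (r - \<rho>)))
        + \<mu> / (s * (r - \<rho>))\<^sup>2 * ((s * (r - \<rho>)) powr \<beta> * v (s * (r - \<rho>)))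
      = ((s * (r - \<rho>)) powr \<beta> * v (s * (r - \<rho>))) powr p"
      using eq[OF t] unfolding X_def by simp
  qed
qed

section \<open>The truncated nonlinearity and its constants\<close>

text \<open>Clipping to \<open>[w0 / 2, 3 * w0 / 2]\<close> makes \<open>y powr p\<close> globally Lipschitz; near \<open>0\<close> the
  solutions never leave this interval.\<close>

definition clip :: "real \<Rightarrow> real" where
  "clip y = max (w0 / 2) (min y (3 * w0 / 2))"

definition f :: "real \<Rightarrow> real \<Rightarrow> real" where
  "f t y = F t (clip y)"

text \<open>For \<open>0 \<le> t \<le> \<rho> / 2\<close> the radius stays between
  \<open>\<rho> / 2\<close> and \<open>2 * \<rho>\<close>; this and the next two constants bound
  \<open>m\<close> and \<open>\<bar>a\<bar>\<close> there.\<close>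

definition m_min :: real where "m_min = (\<rho> / 2) powr (real N - 1)"

definition m_max :: real where "m_max = (2 * \<rho>) powr (real N - 1)"

definition a_max :: real where "a_max = (real N - 1) / (\<rho> / 2)"

text \<open>\<open>A\<close> inserts the largest clipped value \<open>3 * w0 / 2\<close> into both
  terms of \<open>F\<close>; \<open>L\<close> below uses bounds for their slopes in \<open>y\<close>
  on the clipped range, for the power the slope at \<open>w0 / 2\<close>.\<close>

definition A :: real where
  "A = m_max * ((3 * w0 / 2) powr p + \<beta> * a_max * (3 * w0 / 2))"

definition L :: real where
  "L = m_max * (p * (w0 / 2) powr (p - 1) + \<beta> * a_max)"

lemma clip_bounds: "w0 / 2 \<le> clip y" "clip y \<le> 3 * w0 / 2" "0 < clip y"
  unfolding clip_def using w0 by linarith+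

lemma clip_lipschitz: "\<bar>clip x - clip y\<bar> \<le> \<bar>x - y\<bar>"
  unfolding clip_def by linarith

lemma clip_id: "\<bar>y - w0\<bar> \<le> w0 / 2 \<Longrightarrow> clip y = y"
  unfolding clip_def by linarith

text \<open>Mean value theorem: as \<open>p < 1\<close>, the derivative
  \<open>p * z powr (p - 1)\<close> decreases in \<open>z\<close>, so on [w0/2, \<infinity>) it is
  largest at \<open>w0 / 2\<close>.\<close>

lemma powr_lipschitz:
  assumes "w0 / 2 \<le> x" "w0 / 2 \<le> y"
  shows "\<bar>x powr p - y powr p\<bar> \<le> p * (w0 / 2) powr (p - 1) * \<bar>x - y\<bar>"
proof -
  have "norm (x powr p - y powr p) \<le> p * (w0 / 2) powr (p - 1) * norm (x - y)"
  proof (rule field_differentiable_bound[where S = "{w0 / 2..}" and f = "\<lambda>z. z powr p"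
        and f' = "\<lambda>z. p * z powr (p - 1)"])
    fix z assume z: "z \<in> {w0 / 2..}"
    then show "((\<lambda>z. z powr p) has_field_derivative p * z powr (p - 1)) (at z within {w0 / 2..})"
      using w0 by (intro has_field_derivative_at_within[OF has_real_derivative_powr]) auto
    show "norm (p * z powr (p - 1)) \<le> p * (w0 / 2) powr (p - 1)"
    proof -
      have "z powr (p - 1) \<le> (w0 / 2) powr (p - 1)"
        using z p w0 by (intro powr_mono2') auto
      then show ?thesis using p by (simp add: abs_mult)
    qed
  qed (use assms convex_real_interval in auto)
  then show ?thesis by simp
qed

lemma m_bounds:
  assumes "0 \<le> t" "t \<le> \<rho> / 2"
  shows "m_min \<le> m t" "m t \<le> m_max" "0 < m_min"
  using radius_bounds[OF assms] N \<rho> unfolding m_min_def m_max_def m_def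
  by (auto intro!: powr_mono2)

lemma a_bound:
  assumes "0 \<le> t" "t \<le> \<rho> / 2"
  shows "\<bar>a t\<bar> \<le> a_max"
proof -
  have "\<bar>a t\<bar> = (real N - 1) / (\<rho> + s * t)"
    using radius_bounds[OF assms] N \<rho> s by (auto simp: a_def abs_mult)
  then show ?thesis
    using radius_bounds[OF assms] N \<rho> unfolding a_max_def by (simp only:) (intro frac_le; simp)
qed

text \<open>Both \<open>f\<close> and differences of \<open>f\<close> have this shape, so one
  estimate serves \<open>f_bound\<close> and \<open>f_lipschitz\<close>. For
  \<open>t \<le> 1\<close> each power of \<open>t\<close> is at most \<open>t powr \<kappa>\<close>,
  as \<kappa> is the smaller exponent.\<close>

lemma weighted_bound:
  assumes t: "0 \<le> t" "t \<le> \<rho> / 2" "t \<le> 1" and x: "\<bar>x\<bar> \<le> B" and y: "\<bar>y\<bar> \<le> B'"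
  shows "\<bar>m t * (t powr (\<beta> * (1 + p)) * x - \<beta> * a t * t powr (2 * \<beta> - 1) * y)\<bar>
    \<le> m_max * (B + \<beta> * a_max * B') * t powr \<kappa>"
proof -
  have "\<bar>t powr (\<beta> * (1 + p)) * x\<bar> \<le> t powr \<kappa> * B"
    unfolding abs_mult using x t by (intro mult_mono) (auto intro!: powr_mono' simp: \<kappa>_eq)
  moreover have "\<bar>\<beta> * a t * t powr (2 * \<beta> - 1) * y\<bar> \<le> \<beta> * a_max * t powr \<kappa> * B'"
    unfolding abs_mult using y t beta_gt_half a_bound[OF t(1,2)]
    by (intro mult_mono mult_nonneg_nonneg) (auto intro!: powr_mono' simp: \<kappa>_eq)
  ultimately have *: "\<bar>t powr (\<beta> * (1 + p)) * x - \<beta> * a t * t powr (2 * \<beta> - 1) * y\<bar>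
      \<le> (B + \<beta> * a_max * B') * t powr \<kappa>"
    by (simp add: algebra_simps)
  show ?thesis
    unfolding abs_mult[of "m t"] mult.assoc[of m_max]
    using m_bounds[OF t(1,2)] by (intro mult_mono *) auto
qed

lemma f_bound:
  assumes "0 \<le> t" "t \<le> \<rho> / 2" "t \<le> 1"
  shows "\<bar>f t y\<bar> \<le> A * t powr \<kappa>"
  unfolding f_def F_def A_def using clip_bounds[of y] p
  by (intro weighted_bound assms) (auto intro!: powr_mono2)

lemma f_lipschitz:
  assumes "0 \<le> t" "t \<le> \<rho> / 2" "t \<le> 1"
  shows "\<bar>f t x - f t y\<bar> \<le> L * t powr \<kappa> * \<bar>x - y\<bar>"
proof -
  have "f t x - f t y = m t * (t powr (\<beta> * (1 + p)) * (clip x powr p - clip y powr p)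
      - \<beta> * a t * t powr (2 * \<beta> - 1) * (clip x - clip y))"
    by (simp add: f_def F_def algebra_simps)
  also have "\<bar>\<dots>\<bar> \<le> m_max * (p * (w0 / 2) powr (p - 1) * \<bar>clip x - clip y\<bar>
      + \<beta> * a_max * \<bar>clip x - clip y\<bar>) * t powr \<kappa>"
    by (intro weighted_bound assms powr_lipschitz clip_bounds) simp
  also have "\<dots> = L * t powr \<kappa> * \<bar>clip x - clip y\<bar>"
    by (simp add: L_def algebra_simps)
  also have "\<dots> \<le> L * t powr \<kappa> * \<bar>x - y\<bar>"
    using clip_lipschitz m_bounds[OF assms(1,2)] p beta_gt_half a_bound[OF assms(1,2)]
    by (intro mult_left_mono) (auto simp: L_def intro!: mult_nonneg_nonneg add_nonneg_nonneg)
  finally show ?thesis .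
qed

lemma m_cont: "e \<le> \<rho> / 2 \<Longrightarrow> continuous_on {0..e} m"
  unfolding m_def[abs_def]
  by (intro continuous_intros) (use radius_bounds \<rho> in fastforce)

lemma a_cont: "e \<le> \<rho> / 2 \<Longrightarrow> continuous_on {0..e} a"
  unfolding a_def[abs_def]
  by (intro continuous_intros) (use radius_bounds \<rho> in fastforce)

lemma f_cont:
  assumes "e \<le> \<rho> / 2"
  shows "continuous_on ({0..e} \<times> UNIV) (\<lambda>(t, y). f t y)"
proof -
  have fst: "continuous_on ({0..e} \<times> UNIV) (\<lambda>x. g (fst x))" if "continuous_on {0..e} g"
    for g :: "real \<Rightarrow> real"
    by (rule continuous_on_compose2[OF that continuous_on_fst[OF continuous_on_id]]) auto
  have clip: "continuous_on S (\<lambda>x. clip (snd x))" for S :: "(real \<times> real) set"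
    unfolding clip_def by (intro continuous_intros)
  \<comment> \<open>Positive exponents make the powers of \<open>t\<close> continuous up to
    \<open>t = 0\<close>.\<close>
  have exps: "0 < \<beta> * (1 + p)" "0 < 2 * \<beta> - 1"
    using beta_gt_half p by auto
  have powr: "continuous_on {0..e} (\<lambda>t. t powr k)" if "0 < k" for k :: real
    using that by (intro continuous_on_powr') (auto intro!: continuous_intros)
  have "\<forall>x\<in>{0..e} \<times> UNIV. clip (snd x) \<noteq> 0"
    using clip_bounds(3) by (metis less_irrefl)
  then have clip_powr: "continuous_on ({0..e} \<times> UNIV) (\<lambda>x. clip (snd x) powr p)"
    by (intro continuous_on_powr clip continuous_on_const)
  show ?thesis
    unfolding f_def F_def case_prod_unfold
    by (intro continuous_on_mult continuous_on_diff continuous_on_const clip clip_powr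
        fst[OF m_cont[OF assms]] fst[OF a_cont[OF assms]] fst[OF powr[OF exps(1)]] fst[OF powr[OF exps(2)]])
qed

lemma ivp:
  assumes e: "0 < e" "e \<le> \<rho> / 2" "e \<le> 1" and small: "L / (m_min * \<alpha>) * e powr \<alpha> \<le> 1 / 2"
  shows "singular_ivp P e m_min m_max (2 * \<beta>) f A L \<kappa> e"
proof
  show "continuous_on {0<..e} P"
    unfolding P_def[abs_def]
    by (intro continuous_intros continuous_on_subset[OF m_cont[OF e(2)]]) auto
  show "m_min * t powr (2 * \<beta>) \<le> P t" if "0 < t" "t \<le> e" for t
    unfolding P_def using m_bounds[of t] that e by (intro mult_right_mono) auto
  show "P t \<le> m_max * t" if t: "0 < t" "t \<le> e" for t
  proof -
    \<comment> \<open>Holds since \<open>2 * \<beta> > 1\<close> and \<open>t \<le> 1\<close>; it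
      gives the linear bound that uniqueness relies on.\<close>
    have "t powr (2 * \<beta>) \<le> t powr 1"
      using t e beta_gt_half by (intro powr_mono') auto
    then show ?thesis
      unfolding P_def using m_bounds[of t] t e by (intro mult_mono) auto
  qed
  show "0 < m_min" using m_bounds[of 0] \<rho> by simp
  show "0 \<le> \<kappa>" using \<kappa>_pos by simp
  show "2 * \<beta> < \<kappa> + 2" using alpha_pos by (simp add: \<kappa>_def)
  show "L / (m_min * (\<kappa> + 2 - 2 * \<beta>)) * e powr (\<kappa> + 2 - 2 * \<beta>) \<le> 1 / 2"
    using small by (simp add: \<kappa>_def)
  show "continuous_on ({0..e} \<times> UNIV) (\<lambda>(t, y). f t y)"
    by (rule f_cont[OF e(2)])
  show "\<bar>f t y\<bar> \<le> A * t powr \<kappa>" if "0 \<le> t" "t \<le> e" for t y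
    using that e by (intro f_bound) auto
  show "\<bar>f t x - f t y\<bar> \<le> L * t powr \<kappa> * \<bar>x - y\<bar>" if "0 \<le> t" "t \<le> e" for t x y
    using that e by (intro f_lipschitz) auto
qed (use e in auto)

text \<open>The first smallness condition gives the contraction. The second keeps the solution
  within \<open>w0 / 4\<close> of \<open>w0\<close>, strictly inside the range where
  \<open>clip\<close> is the identity; this margin prevents any competing profile from leaving that
  range in \<open>local_solution\<close>.\<close>

lemma small_radius:
  assumes "0 < D"
  obtains e where "0 < e" "e < D" "e \<le> \<rho> / 2" "e \<le> 1"
    "L / (m_min * \<alpha>) * e powr \<alpha> \<le> 1 / 2" "A / (m_min * \<alpha>) * e powr \<alpha> \<le> w0 / 4"
proof -
  have lim: "((\<lambda>e. k * e powr \<alpha>) \<longlongrightarrow> 0) (at_right 0)" for k :: real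
  proof -
    have "\<forall>\<^sub>F e in at_right 0. 0 \<le> (e :: real)"
      by (rule eventually_mono[OF eventually_at_right_less]) simp
    then have "((\<lambda>e. k * e powr \<alpha>) \<longlongrightarrow> k * 0 powr \<alpha>) (at_right 0)"
      using alpha_pos
      by (intro tendsto_mult[OF tendsto_const] tendsto_powr'[OF tendsto_ident_at tendsto_const]) simp
    then show ?thesis by simp
  qed
  have "\<forall>\<^sub>F e in at_right 0. e \<in> {0<..<min D (min (\<rho> / 2) 1)}"
    using assms \<rho> by (intro eventually_at_right_real) auto
  moreover have "\<forall>\<^sub>F e in at_right 0. L / (m_min * \<alpha>) * e powr \<alpha> < 1 / 2"
    by (rule order_tendstoD(2)[OF lim]) simp
  moreover have "\<forall>\<^sub>F e in at_right 0. A / (m_min * \<alpha>) * e powr \<alpha> < w0 / 4"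
    by (rule order_tendstoD(2)[OF lim]) (use w0 in simp)
  ultimately have "\<forall>\<^sub>F e in at_right 0. 0 < e \<and> e < D \<and> e \<le> \<rho> / 2 \<and> e \<le> 1 \<and>
      L / (m_min * \<alpha>) * e powr \<alpha> \<le> 1 / 2 \<and> A / (m_min * \<alpha>) * e powr \<alpha> \<le> w0 / 4"
    by eventually_elim auto
  then show ?thesis
    using that eventually_happens'[OF trivial_limit_at_right_real] by blast
qed

lemma f_eq_F: "\<bar>y - w0\<bar> \<le> w0 / 2 \<Longrightarrow> f t y = F t y"
  by (simp add: f_def clip_id)

section \<open>The one-sided derivative at the boundary\<close>

text \<open>When \<open>\<beta> * (1 - p) < 1\<close>, the power term of \<open>F\<close> is negligible at \<open>0\<close> against the drift term, so
  that \<open>(P * w')'\<close> behaves like \<open>- \<beta> * a 0 * m 0 * w0 * t powr (2 * \<beta> - 1)\<close>.\<close>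

lemma derivative_at_0:
  assumes ivp: "singular_ivp P e m_min m_max (2 * \<beta>) f A L \<kappa> e" and e: "0 < e" "e \<le> \<rho> / 2"
    and w: "continuous_on {0..e} w" "w 0 = w0"
    and w_eq: "\<And>x. 0 \<le> x \<Longrightarrow> x \<le> e \<Longrightarrow> w x = w0 + singular_weight.solop P (\<lambda>t. f t (w t)) x"
    and less_1: "\<beta> * (1 - p) < 1"
  shows "(w has_real_derivative - (a 0 / 2) * w0) (at 0 within {0..e})"
proof -
  interpret I: singular_ivp P e m_min m_max "2 * \<beta>" f A L \<kappa> e by (rule ivp)
  define h where "h t = f t (w t)" for t
  have h: "continuous_on {0..e} h"
    unfolding h_def by (rule I.f_comp_cont[OF order_refl w(1)])
  have h_bound: "\<bar>h t\<bar> \<le> A * t powr \<kappa>" if "0 \<le> t" "t \<le> e" for t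
    unfolding h_def by (rule I.f_bound[OF that])
  have near: "\<forall>\<^sub>F t in at_right 0. t \<in> {0<..<e}"
    using e by (intro eventually_at_right_real)
  have nonneg: "\<forall>\<^sub>F t in at_right 0. 0 \<le> (t :: real)"
    by (rule eventually_mono[OF eventually_at_right_less]) simp
  have at_0: "(g \<longlongrightarrow> g 0) (at_right 0)" if "continuous_on {0..e} g" for g :: "real \<Rightarrow> real"
  proof -
    have "(g \<longlongrightarrow> g 0) (at 0 within {0..e})" using that e by (simp add: continuous_on)
    then show ?thesis using e by (simp add: at_within_Icc_at_right)
  qed
  have lim_m: "(m \<longlongrightarrow> m 0) (at_right 0)" and lim_a: "(a \<longlongrightarrow> a 0) (at_right 0)"
    and lim_w: "(w \<longlongrightarrow> w0) (at_right 0)"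
    using at_0[OF m_cont[OF e(2)]] at_0[OF a_cont[OF e(2)]] at_0[OF w(1)] w(2) by auto
  have m0: "0 < m 0" using \<rho> by (simp add: m_def)
  have near_w: "\<forall>\<^sub>F t in at_right 0. \<bar>w t - w0\<bar> < w0 / 2"
    using tendstoD[OF lim_w, of "w0 / 2"] w0 by (simp add: dist_real_def)
  \<comment> \<open>Since \<open>\<beta> * (1 + p) = q + (2 * \<beta> - 1)\<close>, the power term
    carries the vanishing factor \<open>t powr q\<close> relative to the drift term.\<close>
  define q where "q = 1 - \<beta> * (1 - p)"
  have q: "0 < q" using less_1 by (simp add: q_def)
  \<comment> \<open>The denominator is the derivative of \<open>t powr (2 * \<beta>)\<close>, as
    l'Hopital's rule will require; the factor 1/2 in the limit is
    \<open>\<beta> / (2 * \<beta>)\<close>.\<close>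
  have lim_h: "((\<lambda>t. h t / (2 * \<beta> * t powr (2 * \<beta> - 1))) \<longlongrightarrow> - (a 0 / 2) * m 0 * w0) (at_right 0)"
  proof -
    have "((\<lambda>t. m t * (t powr q * w t powr p - \<beta> * a t * w t) / (2 * \<beta>))
        \<longlongrightarrow> m 0 * (0 powr q * w0 powr p - \<beta> * a 0 * w0) / (2 * \<beta>)) (at_right 0)"
      using q w0 beta_gt_half nonneg
      by (intro tendsto_intros tendsto_powr'[OF tendsto_ident_at tendsto_const] lim_m lim_a lim_w) auto
    also have "m 0 * (0 powr q * w0 powr p - \<beta> * a 0 * w0) / (2 * \<beta>) = - (a 0 / 2) * m 0 * w0"
      using beta_gt_half by simp
    finally show ?thesis
    proof (rule Lim_transform_eventually)
      show "\<forall>\<^sub>F t in at_right 0. m t * (t powr q * w t powr p - \<beta> * a t * w t) / (2 * \<beta>)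
          = h t / (2 * \<beta> * t powr (2 * \<beta> - 1))"
        using near near_w
      proof eventually_elim
        case (elim t)
        have exponent: "t powr (\<beta> * (1 + p)) = t powr q * t powr (2 * \<beta> - 1)"
          by (subst powr_add[symmetric]) (simp add: q_def algebra_simps)
        have "h t = t powr (2 * \<beta> - 1) * (m t * (t powr q * w t powr p - \<beta> * a t * w t))"
          unfolding h_def f_eq_F[OF less_imp_le[OF elim(2)]] F_def exponent
          by (simp add: algebra_simps)
        then show ?case using elim(1) by simp
      qed
    qed
  qed
  have "((\<lambda>t. integral {0..t} h / t powr (2 * \<beta>)) \<longlongrightarrow> - (a 0 / 2) * m 0 * w0) (at_right 0)"
  proof (rule lhopital_right_0[OF _ _ _ _ _ _ lim_h])
    have "continuous_on {0..e} (\<lambda>t. integral {0..t} h)"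
      by (intro indefinite_integral_continuous_1 integrable_continuous_real h)
    from at_0[OF this] show "((\<lambda>t. integral {0..t} h) \<longlongrightarrow> 0) (at_right 0)" by simp
    have "((\<lambda>t. t powr (2 * \<beta>)) \<longlongrightarrow> 0 powr (2 * \<beta>)) (at_right 0)"
      using beta_gt_half nonneg by (intro tendsto_powr'[OF tendsto_ident_at tendsto_const]) auto
    then show "((\<lambda>t. t powr (2 * \<beta>)) \<longlongrightarrow> 0) (at_right 0)" by simp
    show "\<forall>\<^sub>F t in at_right 0. t powr (2 * \<beta>) \<noteq> 0"
      using near by eventually_elim simp
    show "\<forall>\<^sub>F t in at_right 0. 2 * \<beta> * t powr (2 * \<beta> - 1) \<noteq> 0"
      using near by eventually_elim (use beta_gt_half in simp)
    show "\<forall>\<^sub>F t in at_right 0. ((\<lambda>t. integral {0..t} h) has_real_derivative h t) (at t)"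
      using near
    proof eventually_elim
      case (elim t)
      have "((\<lambda>t. integral {0..t} h) has_real_derivative h t) (at t within {0..e})"
        using elim by (intro integral_has_real_derivative h) auto
      then show ?case using elim by (simp add: at_within_Icc_at)
    qed
    show "\<forall>\<^sub>F t in at_right 0. ((\<lambda>t. t powr (2 * \<beta>)) has_real_derivative 2 * \<beta> * t powr (2 * \<beta> - 1)) (at t)"
      using near by eventually_elim (intro has_real_derivative_powr, simp)
  qed
  \<comment> \<open>As \<open>P t = m t * t powr (2 * \<beta>)\<close>, dividing by \<open>m\<close>
    turns the quotient into the flux.\<close>
  from tendsto_divide[OF this lim_m]
  have lim_flux: "(I.flux h \<longlongrightarrow> - (a 0 / 2) * w0) (at_right 0)"
    using m0 by (simp add: I.flux_def[abs_def] P_def mult.commute)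
  \<comment> \<open>A second use of l'Hopital's rule: \<open>w' = flux h\<close> on (0, e), so the
    difference quotient has the limit of the flux.\<close>
  have "((\<lambda>t. (w t - w0) / t) \<longlongrightarrow> - (a 0 / 2) * w0) (at_right 0)"
  proof (rule lhopital_right_0[where f' = "I.flux h" and g' = "\<lambda>_. 1"])
    show "((\<lambda>t. w t - w0) \<longlongrightarrow> 0) (at_right 0)"
      using tendsto_diff[OF lim_w tendsto_const, of w0] by simp
    show "\<forall>\<^sub>F t in at_right 0. ((\<lambda>t. w t - w0) has_real_derivative I.flux h t) (at t)"
      using near
    proof eventually_elim
      case (elim t)
      have "(I.solop h has_real_derivative I.flux h t) (at t)"
        using elim by (intro I.solop_deriv[OF order_refl h I.\<kappa> h_bound]) auto
      then show ?case
        by (rule has_field_derivative_transform_within_open[of _ _ _ "{0<..<e}"])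
           (use elim w_eq in \<open>auto simp: h_def[abs_def]\<close>)
    qed
    show "\<forall>\<^sub>F t in at_right 0. (t :: real) \<noteq> 0" using near by eventually_elim simp
  qed (use lim_flux in \<open>auto intro: tendsto_ident_at\<close>)
  then show ?thesis
    using e w(2) by (simp add: has_field_derivative_iff at_within_Icc_at_right)
qed

section \<open>Existence, uniqueness and asymptotics at one boundary component\<close>

lemma local_solution:
  assumes D: "0 < D"
  obtains e w where "e \<in> {0<..<D}"
    and "local_profile N p \<mu> (\<lambda>r. s * (r - \<rho>)) w0 e w"
    and "\<And>\<epsilon> v d. 0 < \<epsilon> \<Longrightarrow> local_profile N p \<mu> (\<lambda>r. s * (r - \<rho>)) w0 \<epsilon> v \<Longrightarrow>
      d \<in> {0..min e \<epsilon>} \<Longrightarrow> v d = w d"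
    and "(\<lambda>d. w d - w 0) \<in> O[at_right 0](\<lambda>d. d powr \<alpha>)"
    and "- p / (1 - p)\<^sup>2 < \<mu> \<Longrightarrow>
      (w has_real_derivative - (s * (real N - 1) / (2 * \<rho>)) * w 0) (at 0 within {0..e})"
proof -
  obtain e where e: "0 < e" "e < D" "e \<le> \<rho> / 2" "e \<le> 1"
    and small: "L / (m_min * \<alpha>) * e powr \<alpha> \<le> 1 / 2" "A / (m_min * \<alpha>) * e powr \<alpha> \<le> w0 / 4"
    by (rule small_radius[OF D])
  have ivp_e: "singular_ivp P e m_min m_max (2 * \<beta>) f A L \<kappa> e"
    by (rule ivp[OF e(1,3,4) small(1)])
  interpret I: singular_ivp P e m_min m_max "2 * \<beta>" f A L \<kappa> e by (rule ivp_e)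
  have radius_pos: "0 < \<rho> + s * t" if "0 < t" "t < e" for t
    using radius_bounds(1)[of t] that e \<rho> by linarith
  \<comment> \<open>The solution of the truncated problem; \<open>w_near\<close> will show that the
    truncation is inactive along it.\<close>
  obtain w where w: "continuous_on {0..e} w"
    and w_eq: "\<And>x. 0 \<le> x \<Longrightarrow> x \<le> e \<Longrightarrow> w x = w0 + I.solop (\<lambda>t. f t (w t)) x"
    by (rule I.fixpoint_exists[of w0]) blast
  have w_0: "w 0 = w0" using w_eq[of 0] e by simp
  define h where "h t = f t (w t)" for t
  have h: "continuous_on {0..e} h"
    unfolding h_def by (rule I.f_comp_cont[OF order_refl w])
  have h_bound: "\<bar>h t\<bar> \<le> A * t powr \<kappa>" if "0 \<le> t" "t \<le> e" for t
    unfolding h_def by (rule I.f_bound[OF that])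
  have A: "0 \<le> A" using h_bound[of e] e by (smt (verit) mult_neg_pos powr_gt_zero)
  have w_bound: "\<bar>w x - w0\<bar> \<le> A / (m_min * \<alpha>) * x powr \<alpha>" if "0 \<le> x" "x \<le> e" for x
    using I.solop_bound[OF order_refl h I.\<kappa> h_bound that] w_eq[OF that]
    by (simp add: h_def[abs_def] \<kappa>_def)
  have w_near: "\<bar>w x - w0\<bar> \<le> w0 / 4" if "0 \<le> x" "x \<le> e" for x
  proof -
    have "A / (m_min * \<alpha>) * x powr \<alpha> \<le> A / (m_min * \<alpha>) * e powr \<alpha>"
      using that A I.c_pos alpha_pos by (intro mult_left_mono powr_mono2) auto
    then show ?thesis using w_bound[OF that] small(2) by linarith
  qed
  have "radial_hardy_solution_on N p \<mu> (\<lambda>r. s * (r - \<rho>)) {r. 0 < s * (r - \<rho>) \<and> s * (r - \<rho>) < e}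
      (\<lambda>r. (s * (r - \<rho>)) powr \<beta> * w (s * (r - \<rho>)))"
  proof (rule divergence_to_radial[where ?v1.0 = "I.flux h"])
    fix t assume t: "0 < t" "t < e"
    show "0 < \<rho> + s * t" by (rule radius_pos[OF t])
    have near: "\<bar>w t - w0\<bar> \<le> w0 / 4" using w_near t by simp
    then show "0 \<le> w t" using w0 by linarith
    have "(I.solop h has_real_derivative I.flux h t) (at t)"
      using t by (intro I.solop_deriv[OF order_refl h I.\<kappa> h_bound]) auto
    then have "((\<lambda>t. w0 + I.solop h t) has_real_derivative I.flux h t) (at t)"
      by (auto intro!: derivative_eq_intros)
    then show "(w has_real_derivative I.flux h t) (at t)"
      by (rule has_field_derivative_transform_within_open[of _ _ _ "{0<..<e}"])
         (use t w_eq in \<open>auto simp: h_def[abs_def]\<close>)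
    have "((\<lambda>t. P t * I.flux h t) has_real_derivative h t) (at t)"
      using t by (intro I.P_flux_deriv[OF order_refl h I.\<kappa> h_bound]) auto
    moreover have "h t = F t (w t)"
      using near w0 by (simp add: h_def f_eq_F)
    ultimately show "((\<lambda>t. P t * I.flux h t) has_real_derivative F t (w t)) (at t)" by simp
  qed
  then have profile: "local_profile N p \<mu> (\<lambda>r. s * (r - \<rho>)) w0 e w"
    by (simp add: local_profile_def w w_0)
  have unique: "v d = w d"
    if "0 < \<epsilon>" and v: "local_profile N p \<mu> (\<lambda>r. s * (r - \<rho>)) w0 \<epsilon> v" and d: "d \<in> {0..min e \<epsilon>}"
    for \<epsilon> v d
  proof -
    define e' where "e' = min e \<epsilon>"
    have e': "0 < e'" "e' \<le> e" "e' \<le> \<epsilon>" using that(1) e by (auto simp: e'_def)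
    have v_cont: "continuous_on {0..x} v" if "x \<le> e'" for x
      using v e' that unfolding local_profile_def by (auto intro: continuous_on_subset)
    have v_0: "v 0 = w0" using v by (simp add: local_profile_def)
    have "radial_hardy_solution_on N p \<mu> (\<lambda>r. s * (r - \<rho>)) {r. 0 < s * (r - \<rho>) \<and> s * (r - \<rho>) < e'}
        (\<lambda>r. (s * (r - \<rho>)) powr \<beta> * v (s * (r - \<rho>)))"
      using v e' unfolding local_profile_def radial_hardy_solution_on_def by fastforce
    then obtain v1 where v1: "\<And>t. 0 < t \<Longrightarrow> t < e' \<Longrightarrow> (v has_real_derivative v1 t) (at t)"
      and Pv1: "\<And>t. 0 < t \<Longrightarrow> t < e' \<Longrightarrow> 0 \<le> v t \<Longrightarrow>
        ((\<lambda>t. P t * v1 t) has_real_derivative F t (v t)) (at t)"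
      by (rule radial_to_divergence[rotated]) (use radius_pos e' in auto)
    \<comment> \<open>While \<open>v\<close> stays where \<open>clip\<close> is the identity, it
      solves the truncated equation; \<open>solop_unique\<close> turns this into the integral
      equation, whose solution is unique. Closeness is required only for \<open>0 < t < x\<close>,
      yet the conclusion includes \<open>x\<close>.\<close>
    have agree: "v y = w y"
      if x: "0 \<le> x" "x \<le> e'" and near: "\<And>t. 0 < t \<Longrightarrow> t < x \<Longrightarrow> \<bar>v t - w0\<bar> \<le> w0 / 2"
        and y: "0 \<le> y" "y \<le> x" for x y
    proof -
      have xe: "x \<le> e" using x e' by simp
      have vx: "continuous_on {0..x} v" by (rule v_cont[OF x(2)])
      have fv: "continuous_on {0..x} (\<lambda>t. f t (v t))"
        by (rule I.f_comp_cont[OF xe vx])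
      have fv_bound: "\<bar>f t (v t)\<bar> \<le> A * t powr \<kappa>" if "0 \<le> t" "t \<le> x" for t
        using I.f_bound that xe by auto
      have "((\<lambda>t. P t * v1 t) has_real_derivative f t (v t)) (at t)" if t: "0 < t" "t < x" for t
      proof -
        have "0 \<le> v t" using near[OF t] w0 by linarith
        then show ?thesis using Pv1[of t] t x near[OF t] by (simp add: f_eq_F)
      qed
      then have v_eq: "v z = w0 + I.solop (\<lambda>t. f t (v t)) z" if "0 \<le> z" "z \<le> x" for z
        using I.solop_unique[OF xe fv I.\<kappa> fv_bound vx v1 _ that] x v_0 by auto
      show ?thesis
        using w_eq xe
        by (intro I.fixpoint_unique[OF x(1) xe vx continuous_on_subset[OF w] v_eq _ y]) auto
    qed
    \<comment> \<open>First-exit argument: let \<open>x\<close> be the least point with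
      \<open>\<bar>v x - w0\<bar> \<ge> w0 / 2\<close>. Then \<open>agree\<close> gives
      \<open>v x = w x\<close>, but \<open>w x\<close> is within \<open>w0 / 4\<close> of
      \<open>w0\<close>.\<close>
    have near: "\<bar>v t - w0\<bar> < w0 / 2" if t: "0 \<le> t" "t \<le> e'" for t
    proof (rule ccontr)
      assume not: "\<not> \<bar>v t - w0\<bar> < w0 / 2"
      define Z where "Z = {t \<in> {0..e'}. w0 / 2 \<le> \<bar>v t - w0\<bar>}"
      have "closed Z"
        unfolding Z_def
        by (intro continuous_on_closed_Collect_le continuous_intros v_cont) auto
      then have "compact Z"
        using compact_Int_closed[of "{0..e'}" Z] by (simp add: Int_absorb1 Z_def subset_eq)
      moreover have "Z \<noteq> {}" using not t by (auto simp: Z_def)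
      ultimately obtain x where x: "x \<in> Z" "\<And>y. y \<in> Z \<Longrightarrow> x \<le> y"
        using compact_attains_inf[of Z] by blast
      have "\<bar>v y - w0\<bar> \<le> w0 / 2" if "0 < y" "y < x" for y
        using x(2)[of y] x(1) that by (force simp: Z_def)
      then have "v x = w x" using agree[of x x] x(1) by (auto simp: Z_def)
      then show False using w_near[of x] x(1) e' w0 by (auto simp: Z_def)
    qed
    show ?thesis
      by (rule agree[of e' d]) (use near d e' in \<open>auto simp: e'_def intro: less_imp_le\<close>)
  qed
  have bigo: "(\<lambda>d. w d - w 0) \<in> O[at_right 0](\<lambda>d. d powr \<alpha>)"
  proof (rule bigoI)
    have "\<forall>\<^sub>F t in at_right 0. t \<in> {0<..<e}" using e by (intro eventually_at_right_real)
    then show "\<forall>\<^sub>F d in at_right 0. norm (w d - w 0) \<le> A / (m_min * \<alpha>) * norm (d powr \<alpha>)"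
      by eventually_elim (use w_bound w_0 in auto)
  qed
  have deriv: "(w has_real_derivative - (s * (real N - 1) / (2 * \<rho>)) * w 0) (at 0 within {0..e})"
    if "- p / (1 - p)\<^sup>2 < \<mu>"
  proof -
    have "(w has_real_derivative - (a 0 / 2) * w0) (at 0 within {0..e})"
      by (rule derivative_at_0[OF ivp_e e(1,3) w w_0 w_eq beta_less_1[OF that]])
    moreover have "- (a 0 / 2) * w0 = - (s * (real N - 1) / (2 * \<rho>)) * w 0"
      by (simp add: a_def w_0)
    ultimately show ?thesis by (rule DERIV_cong)
  qed
  show ?thesis
  proof (rule that[of e w])
    show "e \<in> {0<..<D}" using e by simp
  qed (fact profile unique bigo deriv)+
qed

end

section \<open>The outer and the inner boundary\<close>

theorem lemma2p5:
  fixes N :: nat and p \<mu> r0 R w0 :: real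
  assumes "1 \<le> N"
    and "0 < p" and "p < 1"
    and "- mu_star p < \<mu>" and "\<mu> < 1/4" and "\<mu> \<noteq> 0"
    and "0 < r0" and "r0 < R"
    and "0 < w0"
  shows "0 < alpha p \<mu> \<and>
    (- p / (1 - p)\<^sup>2 < \<mu> \<longrightarrow> alpha p \<mu> = 1) \<and>
    (\<exists>\<delta>0\<in>{0<..<(R - r0) / 2}. \<exists>w.
        local_profile N p \<mu> (\<lambda>r. R - r) w0 \<delta>0 w \<and>
        (\<forall>\<epsilon>\<in>{0<..<(R - r0) / 2}. \<forall>v. local_profile N p \<mu> (\<lambda>r. R - r) w0 \<epsilon> v \<longrightarrow>
           (\<forall>d\<in>{0..min \<delta>0 \<epsilon>}. v d = w d)) \<and>
        (\<lambda>d. w d - w 0) \<in> O[at_right 0](\<lambda>d. d powr alpha p \<mu>) \<and>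
        (- p / (1 - p)\<^sup>2 < \<mu> \<longrightarrow>
           (w has_real_derivative (real N - 1) / (2 * R) * w 0) (at 0 within {0..\<delta>0}))) \<and>
    (\<exists>\<delta>0\<in>{0<..<(R - r0) / 2}. \<exists>w.
        local_profile N p \<mu> (\<lambda>r. r - r0) w0 \<delta>0 w \<and>
        (\<forall>\<epsilon>\<in>{0<..<(R - r0) / 2}. \<forall>v. local_profile N p \<mu> (\<lambda>r. r - r0) w0 \<epsilon> v \<longrightarrow>
           (\<forall>d\<in>{0..min \<delta>0 \<epsilon>}. v d = w d)) \<and>
        (\<lambda>d. w d - w 0) \<in> O[at_right 0](\<lambda>d. d powr alpha p \<mu>) \<and>
        (- p / (1 - p)\<^sup>2 < \<mu> \<longrightarrow>
           (w has_real_derivative - ((real N - 1) / (2 * r0)) * w 0) (at 0 within {0..\<delta>0})))"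
proof -
  \<comment> \<open>At \<open>r = R\<close> the distance decreases as \<open>r\<close> grows, hence
    \<open>s = -1\<close>; this sign makes the slope of the profile at 0 opposite in sign to the one
    at the inner boundary.\<close>
  interpret outer: hardy_ode N p \<mu> "-1" R w0
    using assms by unfold_locales auto
  interpret inner: hardy_ode N p \<mu> 1 r0 w0
    using assms by unfold_locales auto
  have D: "0 < (R - r0) / 2" using assms by simp
  have outer_eqs: "(\<lambda>r. - 1 * (r - R)) = (\<lambda>r. R - r)"
    "- (- 1 * (real N - 1) / (2 * R)) = (real N - 1) / (2 * R)"
    by (auto simp: minus_divide_left)
  obtain e1 w1 where 1: "e1 \<in> {0<..<(R - r0) / 2}"
    "local_profile N p \<mu> (\<lambda>r. R - r) w0 e1 w1"
    "\<And>\<epsilon> v d. 0 < \<epsilon> \<Longrightarrow> local_profile N p \<mu> (\<lambda>r. R - r) w0 \<epsilon> v \<Longrightarrow> d \<in> {0..min e1 \<epsilon>} \<Longrightarrow> v d = w1 d"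
    "(\<lambda>d. w1 d - w1 0) \<in> O[at_right 0](\<lambda>d. d powr alpha p \<mu>)"
    "- p / (1 - p)\<^sup>2 < \<mu> \<Longrightarrow>
      (w1 has_real_derivative (real N - 1) / (2 * R) * w1 0) (at 0 within {0..e1})"
    by (rule outer.local_solution[OF D, unfolded outer_eqs]) blast
  obtain e2 w2 where 2: "e2 \<in> {0<..<(R - r0) / 2}"
    "local_profile N p \<mu> (\<lambda>r. r - r0) w0 e2 w2"
    "\<And>\<epsilon> v d. 0 < \<epsilon> \<Longrightarrow> local_profile N p \<mu> (\<lambda>r. r - r0) w0 \<epsilon> v \<Longrightarrow> d \<in> {0..min e2 \<epsilon>} \<Longrightarrow> v d = w2 d"
    "(\<lambda>d. w2 d - w2 0) \<in> O[at_right 0](\<lambda>d. d powr alpha p \<mu>)"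
    "- p / (1 - p)\<^sup>2 < \<mu> \<Longrightarrow>
      (w2 has_real_derivative - ((real N - 1) / (2 * r0)) * w2 0) (at 0 within {0..e2})"
    by (rule inner.local_solution[OF D, unfolded mult_1]) blast
  show ?thesis
  proof (intro conjI)
    show "0 < alpha p \<mu>" by (rule inner.alpha_pos)
    show "- p / (1 - p)\<^sup>2 < \<mu> \<longrightarrow> alpha p \<mu> = 1" by (intro impI inner.alpha_eq_1)
    show "\<exists>\<delta>0\<in>{0<..<(R - r0) / 2}. \<exists>w.
        local_profile N p \<mu> (\<lambda>r. R - r) w0 \<delta>0 w \<and>
        (\<forall>\<epsilon>\<in>{0<..<(R - r0) / 2}. \<forall>v. local_profile N p \<mu> (\<lambda>r. R - r) w0 \<epsilon> v \<longrightarrow>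
           (\<forall>d\<in>{0..min \<delta>0 \<epsilon>}. v d = w d)) \<and>
        (\<lambda>d. w d - w 0) \<in> O[at_right 0](\<lambda>d. d powr alpha p \<mu>) \<and>
        (- p / (1 - p)\<^sup>2 < \<mu> \<longrightarrow>
           (w has_real_derivative (real N - 1) / (2 * R) * w 0) (at 0 within {0..\<delta>0}))"
    proof (intro bexI[OF _ 1(1)] exI[of _ w1] conjI ballI allI impI)
      show "v d = w1 d" if "\<epsilon> \<in> {0<..<(R - r0) / 2}"
        "local_profile N p \<mu> (\<lambda>r. R - r) w0 \<epsilon> v" "d \<in> {0..min e1 \<epsilon>}" for \<epsilon> v d
        by (rule 1(3)[OF _ that(2,3)]) (use that(1) in simp)
    qed (fact 1(2) 1(4) | erule 1(5))+
    show "\<exists>\<delta>0\<in>{0<..<(R - r0) / 2}. \<exists>w.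
        local_profile N p \<mu> (\<lambda>r. r - r0) w0 \<delta>0 w \<and>
        (\<forall>\<epsilon>\<in>{0<..<(R - r0) / 2}. \<forall>v. local_profile N p \<mu> (\<lambda>r. r - r0) w0 \<epsilon> v \<longrightarrow>
           (\<forall>d\<in>{0..min \<delta>0 \<epsilon>}. v d = w d)) \<and>
        (\<lambda>d. w d - w 0) \<in> O[at_right 0](\<lambda>d. d powr alpha p \<mu>) \<and>
        (- p / (1 - p)\<^sup>2 < \<mu> \<longrightarrow>
           (w has_real_derivative - ((real N - 1) / (2 * r0)) * w 0) (at 0 within {0..\<delta>0}))"
    proof (intro bexI[OF _ 2(1)] exI[of _ w2] conjI ballI allI impI)
      show "v d = w2 d" if "\<epsilon> \<in> {0<..<(R - r0) / 2}"
        "local_profile N p \<mu> (\<lambda>r. r - r0) w0 \<epsilon> v" "d \<in> {0..min e2 \<epsilon>}" for \<epsilon> v d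
        by (rule 2(3)[OF _ that(2,3)]) (use that(1) in simp)
    qed (fact 2(2) 2(4) | erule 2(5))+
  qed
qed

end
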